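(* Under the regularity and ordered-menu assumptions stated in the context, for every $q\in\mathcal Q$ and every nonempty finite menu $V\subset\mathcal A$, \[ L(V,q)=\begin{cases} b(q)^2/I_V(q), & b(q)\neq 0,\\ 0,& b(q)=0,\end{cases} \qquad L_\star(q)=\begin{cases} b(q)^2/I_\star(q), & b(q)\neq 0,\\ 0,& b(q)=0,\end{cases} \] with the convention $1/0=\infty$ in the branch $b(q)\ne0$. Consequently, if one defines \[ D(q,a)=\begin{cases}0,& b(q)=0,\\ b(q)^2\{I(q,a)^{-1}-I_\star(q)^{-1}\},& b(q)\neq0,\ I(q,a)>0,\\ \infty,& b(q)\neq 0,\ I(q,a)=0,\end{cases} \] then (assuming $I_\star(q)>0$ for every $q\in\mathcal Q$) the optimized worst-context local excess \[ \inf_{V\subset\mathcal A,\ 1\le|V|\le k}\ \sup_{q\in\mathcal Q}\{L(V,q)-L_\star(q)\} \] equals \[ A_k=\inf_{V\subset\mathcal A,\ 1\le |V|\le k}\ \sup_{q\in\mathcal Q}\ \min_{a\in V} D(q,a). \] If $\mathcal Q$ and $\mathcal A$ are compact and $D$ is lower semicontinuous, the infimum defining $A_k$ is attained.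
   Context: $\Theta\subseteq\mathbb R$ is a parameter space, $\mathcal Q$ a context space, $\mathcal A$ an action space; for each $(q,a)$, $\mathcal E_{q,a}=\{P_{\theta,q,a}:\theta\in\Theta\}$ is a one-observation experiment. $\mathcal E\succeq_B\mathcal G$ (Blackwell order) means $\mathcal G$ is obtained from $\mathcal E$ through a Markov kernel not depending on $\theta$. Given a finite menu $V$ and the disclosed $q$, a policy $\Pi$ draws at each stage $i\le n$ an action $A_i\in V$ from a parameter-free Markov kernel depending on $q$ and on the previous actions and outcomes, and then observes $Y_i\sim P_{\theta,q,A_i}$; terminal estimators $T$ are functions of the full record. Fix an interior point $\theta_0$ of $\Theta$. Regularity assumptions: for each $(q,a)$ the one-observation model is differentiable in quadratic mean (DQM) at $\theta_0$ with Fisher information $I(q,a)\ge 0$, and its local experiments are LAN. When $I(q,a)>0$ there is an estimator $\widehat\theta_{n,q,a}$ from $n$ independent observations of $\mathcal E_{q,a}$ such that for every $H<\infty$, \[ \sup_{|h|\le H}\Big|\mathbb E_{\theta_0+h/\sqrt n,q,a}\big[n\{\widehat\theta_{n,q,a}-(\theta_0+h/\sqrt n)\}^2\big]-I(q,a)^{-1}\Big|\to0 . \] The real-valued target $\psi_q$ is differentiable at $\theta_0$; $b(q)=\dot\psi_q(\theta_0)$ and $\psi_{q,n}(h)=\sqrt n\{\psi_q(\theta_0+h/\sqrt n)-\psi_q(\theta_0)\}$. Localized minimax risk: $\mathcal R_{n,H}(V,q)=\inf_{\Pi,T}\sup_{|h|\le H}\mathbb E^{\Pi}_{\theta_0+h/\sqrt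 n,q}\{T-\psi_{q,n}(h)\}^2$, infimum over menu policies $\Pi$ using $V$ and terminal estimators $T$. Put $L(V,q)=\lim_{H\to\infty}\liminf_{n\to\infty}\mathcal R_{n,H}(V,q)$. Ordered-menu assumptions: at each context $q$, every finite menu $V$ has a measurable greatest action $a_V(q)\in V$ (i.e. $\mathcal E_{q,a_V(q)}\succeq_B\mathcal E_{q,a}$ for all $a\in V$), and the full action space has an attained measurable greatest action $a_\star(q)$. Put $I_V(q)=I(q,a_V(q))=\max_{a\in V}I(q,a)$, $I_\star(q)=I(q,a_\star(q))=\sup_{a\in\mathcal A}I(q,a)$, and $L_\star(q)=L(\{a_\star(q)\},q)$. For the global frontier, $I_\star(q)>0$ for every $q\in\mathcal Q$. *)

theory Defs
  imports "HOL-Probability.Probability"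
begin

section \<open>Experiments and the Blackwell order\<close>

text \<open>An experiment is a family \<open>E \<theta>\<close> on a sample space \<open>M\<close>.  Only the members with
  \<open>\<theta> \<in> \<Theta>\<close> are constrained; \<open>E\<close> may be arbitrary elsewhere.\<close>

definition statistical_experiment :: "real set \<Rightarrow> 'y measure \<Rightarrow> (real \<Rightarrow> 'y measure) \<Rightarrow> bool" where
  "statistical_experiment \<Theta> M E \<longleftrightarrow> (\<forall>\<theta>\<in>\<Theta>. E \<theta> \<in> space (prob_algebra M))"

definition blackwell_ge ::
    "real set \<Rightarrow> 'y measure \<Rightarrow> (real \<Rightarrow> 'y measure) \<Rightarrow> 'z measure \<Rightarrow> (real \<Rightarrow> 'z measure) \<Rightarrow> bool" where
  "blackwell_ge \<Theta> M E N G \<longleftrightarrow>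
     (\<exists>K \<in> M \<rightarrow>\<^sub>M prob_algebra N. \<forall>\<theta>\<in>\<Theta>. G \<theta> = E \<theta> \<bind> K)"

section \<open>Local regularity\<close>

text \<open>No dominating measure for the whole family is assumed: \<open>P\<close> and \<open>Q\<close> are compared through
  their densities with respect to \<open>P + Q\<close>.  The quantities below do not depend on the
  dominating measure.\<close>

definition sum_measure :: "'y measure \<Rightarrow> 'y measure \<Rightarrow> 'y measure" where
  "sum_measure P Q = measure_of (space P) (sets P) (\<lambda>A. emeasure P A + emeasure Q A)"

definition real_density :: "'y measure \<Rightarrow> 'y measure \<Rightarrow> 'y \<Rightarrow> real" where
  "real_density \<mu> P y = enn2real (RN_deriv \<mu> P y)"

definition dqm_remainder :: "(real \<Rightarrow> 'y measure) \<Rightarrow> real \<Rightarrow> ('y \<Rightarrow> real) \<Rightarrow> real \<Rightarrow> ennreal" where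
  "dqm_remainder E \<theta>\<^sub>0 s \<theta> =
     (let \<mu> = sum_measure (E \<theta>\<^sub>0) (E \<theta>); p\<^sub>0 = real_density \<mu> (E \<theta>\<^sub>0); p = real_density \<mu> (E \<theta>)
      in \<integral>\<^sup>+ y. ennreal ((sqrt (p y) - sqrt (p\<^sub>0 y) - (\<theta> - \<theta>\<^sub>0) / 2 * s y * sqrt (p\<^sub>0 y))\<^sup>2) \<partial>\<mu>)"

text \<open>Differentiability in quadratic mean at \<open>\<theta>\<^sub>0\<close> with some score \<open>s\<close> and Fisher information
  \<open>J\<close>, the second moment of \<open>s\<close>.\<close>

definition dqm_at ::
    "real set \<Rightarrow> 'y measure \<Rightarrow> (real \<Rightarrow> 'y measure) \<Rightarrow> real \<Rightarrow> real \<Rightarrow> bool" where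
  "dqm_at \<Theta> M E \<theta>\<^sub>0 J \<longleftrightarrow>
     (\<exists>s \<in> borel_measurable M.
        integrable (E \<theta>\<^sub>0) (\<lambda>y. (s y)\<^sup>2) \<and>
        J = (\<integral>y. (s y)\<^sup>2 \<partial>E \<theta>\<^sub>0) \<and>
        ((\<lambda>\<theta>. dqm_remainder E \<theta>\<^sub>0 s \<theta> / ennreal ((\<theta> - \<theta>\<^sub>0)\<^sup>2)) \<longlongrightarrow> 0) (at \<theta>\<^sub>0 within \<Theta>))"

definition likelihood_ratio :: "(real \<Rightarrow> 'y measure) \<Rightarrow> real \<Rightarrow> real \<Rightarrow> 'y \<Rightarrow> real" where
  "likelihood_ratio E \<theta>\<^sub>0 \<theta> y =
     (let \<mu> = sum_measure (E \<theta>\<^sub>0) (E \<theta>) in real_density \<mu> (E \<theta>) y / real_density \<mu> (E \<theta>\<^sub>0) y)"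

text \<open>The normal law with mean 0 and variance \<open>J\<close>; a point mass at 0 if \<open>J = 0\<close>.\<close>

definition centred_normal :: "real \<Rightarrow> real measure" where
  "centred_normal J =
     (if J = 0 then return borel 0 else density lborel (\<lambda>x. ennreal (normal_density 0 (sqrt J) x)))"

text \<open>Local asymptotic normality of the local product experiments.  A vanishing likelihood ratio
  has logarithm \<open>-\<infinity>\<close> and counts as a violation of the expansion; in HOL \<open>ln 0 = 0\<close>, hence the
  explicit positivity.\<close>

definition lan_at ::
    "'y measure \<Rightarrow> (real \<Rightarrow> 'y measure) \<Rightarrow> real \<Rightarrow> real \<Rightarrow> bool" where
  "lan_at M E \<theta>\<^sub>0 J \<longleftrightarrow>
     (\<exists>\<Delta> :: nat \<Rightarrow> (nat \<Rightarrow> 'y) \<Rightarrow> real.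
        (\<forall>n. \<Delta> n \<in> borel_measurable (PiM {..<n} (\<lambda>_. M))) \<and>
        weak_conv_m (\<lambda>n. distr (PiM {..<n} (\<lambda>_. E \<theta>\<^sub>0)) borel (\<Delta> n)) (centred_normal J) \<and>
        (\<forall>(h :: real) (hs :: nat \<Rightarrow> real). hs \<longlonglongrightarrow> h \<longrightarrow>
          (\<forall>\<epsilon>>0. (\<lambda>n. measure (PiM {..<n} (\<lambda>_. E \<theta>\<^sub>0))
              {y \<in> space (PiM {..<n} (\<lambda>_. M)).
                 let r = (\<Prod>i<n. likelihood_ratio E \<theta>\<^sub>0 (\<theta>\<^sub>0 + hs n / sqrt (real n)) (y i))
                 in \<not> (0 < r \<and> \<bar>ln r - (h * \<Delta> n y - h\<^sup>2 * J / 2)\<bar> \<le> \<epsilon>)}) \<longlonglongrightarrow> 0)))"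

text \<open>Local parameters in \<open>[-H, H]\<close>.  The membership in \<open>\<Theta>\<close> only matters for finitely many \<open>n\<close>
  when \<open>\<theta>\<^sub>0\<close> is an interior point.\<close>

definition local_params :: "real set \<Rightarrow> real \<Rightarrow> nat \<Rightarrow> real \<Rightarrow> real set" where
  "local_params \<Theta> \<theta>\<^sub>0 n H = {h. \<bar>h\<bar> \<le> H \<and> \<theta>\<^sub>0 + h / sqrt (real n) \<in> \<Theta>}"

text \<open>The mean squared error is an extended real, so that an infinite risk is not read as 0.\<close>

definition has_efficient_estimator ::
    "real set \<Rightarrow> 'y measure \<Rightarrow> (real \<Rightarrow> 'y measure) \<Rightarrow> real \<Rightarrow> real \<Rightarrow> bool" where
  "has_efficient_estimator \<Theta> M E \<theta>\<^sub>0 J \<longleftrightarrow>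
     (\<exists>est :: nat \<Rightarrow> (nat \<Rightarrow> 'y) \<Rightarrow> real.
        (\<forall>n. est n \<in> borel_measurable (PiM {..<n} (\<lambda>_. M))) \<and>
        (\<forall>H\<ge>0. (\<lambda>n. SUP h \<in> local_params \<Theta> \<theta>\<^sub>0 n H.
            let \<theta> = \<theta>\<^sub>0 + h / sqrt (real n) in
            \<bar>enn2ereal (\<integral>\<^sup>+ y. ennreal (real n * (est n y - \<theta>)\<^sup>2) \<partial>PiM {..<n} (\<lambda>_. E \<theta>))
              - ereal (1 / J)\<bar>) \<longlonglongrightarrow> 0))"

section \<open>Menu policies and localized minimax risk\<close>

text \<open>Everything here is at a fixed, disclosed context: \<open>Y a\<close> is the sample space and \<open>E a\<close> the
  experiment of action \<open>a\<close>.  A stage of the record is a pair of an action of the menu and an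
  outcome in the sample space of that action; \<open>stage_space\<close> is the disjoint union of these sample
  spaces.\<close>

definition stage_space :: "('a \<Rightarrow> 'y measure) \<Rightarrow> 'a set \<Rightarrow> ('a \<times> 'y) measure" where
  "stage_space Y V =
     sigma (SIGMA a:V. space (Y a)) {{a} \<times> B | a B. a \<in> V \<and> B \<in> sets (Y a)}"

definition record_space :: "('a \<Rightarrow> 'y measure) \<Rightarrow> 'a set \<Rightarrow> nat \<Rightarrow> (nat \<Rightarrow> 'a \<times> 'y) measure" where
  "record_space Y V n = PiM {..<n} (\<lambda>_. stage_space Y V)"

text \<open>Stages are numbered from 0: \<open>\<pi> i\<close> chooses the action after \<open>i\<close> completed stages.\<close>

definition menu_policies ::
    "('a \<Rightarrow> 'y measure) \<Rightarrow> 'a set \<Rightarrow> nat \<Rightarrow> (nat \<Rightarrow> (nat \<Rightarrow> 'a \<times> 'y) \<Rightarrow> 'a measure) set" where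
  "menu_policies Y V n =
     {\<pi>. \<forall>i<n. \<pi> i \<in> record_space Y V i \<rightarrow>\<^sub>M prob_algebra (count_space V)}"

text \<open>Law of the record after \<open>n\<close> stages, when action \<open>a\<close> produces an outcome with law \<open>F a\<close>.\<close>

primrec record_law ::
    "('a \<Rightarrow> 'y measure) \<Rightarrow> 'a set \<Rightarrow> (nat \<Rightarrow> (nat \<Rightarrow> 'a \<times> 'y) \<Rightarrow> 'a measure) \<Rightarrow>
     ('a \<Rightarrow> 'y measure) \<Rightarrow> nat \<Rightarrow> (nat \<Rightarrow> 'a \<times> 'y) measure" where
  "record_law Y V \<pi> F 0 = return (record_space Y V 0) (\<lambda>_. undefined)"
| "record_law Y V \<pi> F (Suc i) =
     record_law Y V \<pi> F i \<bind> (\<lambda>w. \<pi> i w \<bind> (\<lambda>a. F a \<bind>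
       (\<lambda>y. return (record_space Y V (Suc i)) (w(i := (a, y))))))"

definition local_target :: "(real \<Rightarrow> real) \<Rightarrow> real \<Rightarrow> nat \<Rightarrow> real \<Rightarrow> real" where
  "local_target \<psi> \<theta>\<^sub>0 n h = sqrt (real n) * (\<psi> (\<theta>\<^sub>0 + h / sqrt (real n)) - \<psi> \<theta>\<^sub>0)"

definition local_minimax_risk ::
    "real set \<Rightarrow> real \<Rightarrow> ('a \<Rightarrow> 'y measure) \<Rightarrow> ('a \<Rightarrow> real \<Rightarrow> 'y measure) \<Rightarrow> (real \<Rightarrow> real) \<Rightarrow>
     'a set \<Rightarrow> nat \<Rightarrow> real \<Rightarrow> ennreal" where
  "local_minimax_risk \<Theta> \<theta>\<^sub>0 Y E \<psi> V n H =
     (INF (\<pi>, T) \<in> menu_policies Y V n \<times> borel_measurable (record_space Y V n).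
        SUP h \<in> local_params \<Theta> \<theta>\<^sub>0 n H.
          \<integral>\<^sup>+ w. ennreal ((T w - local_target \<psi> \<theta>\<^sub>0 n h)\<^sup>2)
            \<partial>record_law Y V \<pi> (\<lambda>a. E a (\<theta>\<^sub>0 + h / sqrt (real n))) n)"

definition limit_risk ::
    "real set \<Rightarrow> real \<Rightarrow> ('a \<Rightarrow> 'y measure) \<Rightarrow> ('a \<Rightarrow> real \<Rightarrow> 'y measure) \<Rightarrow> (real \<Rightarrow> real) \<Rightarrow>
     'a set \<Rightarrow> ennreal" where
  "limit_risk \<Theta> \<theta>\<^sub>0 Y E \<psi> V =
     Lim at_top (\<lambda>H. liminf (\<lambda>n. local_minimax_risk \<Theta> \<theta>\<^sub>0 Y E \<psi> V n H))"

text \<open>The limit in \<open>limit_risk\<close> always exists, by monotonicity in \<open>H\<close>.\<close>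

lemma local_minimax_risk_mono:
  assumes "H \<le> H'"
  shows "local_minimax_risk \<Theta> \<theta>\<^sub>0 Y E \<psi> V n H \<le> local_minimax_risk \<Theta> \<theta>\<^sub>0 Y E \<psi> V n H'"
proof -
  have "local_params \<Theta> \<theta>\<^sub>0 n H \<subseteq> local_params \<Theta> \<theta>\<^sub>0 n H'"
    using assms by (auto simp: local_params_def)
  then show ?thesis
    unfolding local_minimax_risk_def
    by (intro INF_mono) (auto intro!: bexI SUP_subset_mono)
qed

lemma tendsto_limit_risk:
  "((\<lambda>H. liminf (\<lambda>n. local_minimax_risk \<Theta> \<theta>\<^sub>0 Y E \<psi> V n H))
      \<longlongrightarrow> limit_risk \<Theta> \<theta>\<^sub>0 Y E \<psi> V) at_top"
proof -
  let ?f = "\<lambda>H. liminf (\<lambda>n. local_minimax_risk \<Theta> \<theta>\<^sub>0 Y E \<psi> V n H)"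
  have mono: "?f H \<le> ?f H'" if "H \<le> H'" for H H'
    using that by (intro Liminf_mono always_eventually allI local_minimax_risk_mono)
  have "(?f \<longlongrightarrow> (SUP H. ?f H)) at_top"
  proof (rule increasing_tendsto)
    show "\<forall>\<^sub>F H in at_top. ?f H \<le> (SUP H. ?f H)"
      by (intro always_eventually allI SUP_upper) simp
    fix x assume "x < (SUP H. ?f H)"
    then obtain H where "x < ?f H" by (auto simp: less_SUP_iff)
    then show "\<forall>\<^sub>F H in at_top. x < ?f H"
      by (auto intro: eventually_at_top_linorderI[of H] less_le_trans[OF _ mono])
  qed
  then show ?thesis
    unfolding limit_risk_def by (simp add: tendsto_Lim)
qed

section \<open>Menu frontier\<close>

definition menus :: "'a set \<Rightarrow> nat \<Rightarrow> 'a set set" where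
  "menus A k = {V. V \<subseteq> A \<and> finite V \<and> 1 \<le> card V \<and> card V \<le> k}"

text \<open>\<open>info_excess b J Js\<close> is the value of \<open>D\<close> at a point where the target has derivative \<open>b\<close>, the
  action has information \<open>J\<close>, and the greatest action has information \<open>Js\<close>.\<close>

definition info_excess :: "real \<Rightarrow> real \<Rightarrow> real \<Rightarrow> ereal" where
  "info_excess b J Js =
     (if b = 0 then 0 else if J > 0 then ereal (b\<^sup>2 * (1 / J - 1 / Js)) else \<infinity>)"

definition lower_semicontinuous_map :: "'b topology \<Rightarrow> ('b \<Rightarrow> ereal) \<Rightarrow> bool" where
  "lower_semicontinuous_map X f \<longleftrightarrow> (\<forall>c. openin X {x \<in> topspace X. c < f x})"

end

theory Submission
  imports Defs
begin

text \<open>Everything rests on the Hellinger affinity in its dual form, the infimum of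
  \<open>(\<integral>f dP) (\<integral>g dQ)\<close> over \<open>f g \<ge> 1\<close>.  In this form it can only increase under Markov kernels, and it
  is supermultiplicative along an adaptive record: two local parameters are at least as hard to
  tell apart from \<open>n\<close> stages of any policy as from \<open>n\<close> independent observations of the Blackwell
  greatest action.  Differentiability in quadratic mean bounds the one-observation affinity of
  \<open>\<theta>\<^sub>0 + h / \<surd>n\<close> and \<open>\<theta>\<^sub>0 + h' / \<surd>n\<close> below by \<open>1 - J (h - h')\<^sup>2 / (8 n) - o(1 / n)\<close>.  The test functions
  \<open>1 \<plusminus> u + u\<^sup>2 / 2\<close> with \<open>u\<close> proportional to the estimation error turn affinities of neighbouring
  points of a grid into a discrete van Trees inequality, whose limit is \<open>b\<^sup>2 / J\<close>.  The matching upper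
  bound plays one action throughout; applied to an arbitrary action of the menu it also shows
  that the greatest action has maximal information.  The optimal menu exists because the worst-case
  excess is lower semicontinuous on \<open>k\<close>-tuples of actions.\<close>

section \<open>Hellinger affinity\<close>

text \<open>For densities \<open>p\<close>, \<open>q\<close> the choice
  \<open>f = sqrt (q / p)\<close>, \<open>g = sqrt (p / q)\<close> shows that the dual infimum is
  the square of the integral of \<open>sqrt (p * q)\<close>. The obstacle is adaptivity: under an
  arbitrary policy the law of the record has no product structure, its stages live on different
  sample spaces, and Blackwell domination provides kernels rather than densities or scores.
  Integrating test functions stage by stage needs none of these. The constant 8 comes from the
  affinity: the roots of two densities at parameter distance d have squared L2 distance about d^2 J
  / 4, so the affinity is about 1 - d^2 J / 8. After n stages with d = e / sqrt n the deficit is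
  about J e^2 / 8; the van Trees step multiplies it by 8 and compares it with the squared target
  increment b^2 e^2. The factor e^2 cancels and b^2 <= J * risk remains. For a fixed mesh only
  finitely many neighbouring pairs occur, so one large n serves them all before the mesh is
  refined.\<close>

text \<open>The infimum of these products is the squared Hellinger affinity, so that \<open>affinity_ge M P Q \<rho>\<close>
  bounds the affinity from below by \<open>\<rho>\<close> without reference to a dominating measure.\<close>

definition affinity_ge :: "'y measure \<Rightarrow> 'y measure \<Rightarrow> 'y measure \<Rightarrow> real \<Rightarrow> bool" where
  "affinity_ge M P Q \<rho> \<longleftrightarrow>
     (\<forall>f\<in>borel_measurable M. \<forall>g\<in>borel_measurable M. (\<forall>x\<in>space M. 1 \<le> f x * g x) \<longrightarrow>
        ennreal (\<rho>\<^sup>2) \<le> (\<integral>\<^sup>+x. f x \<partial>P) * (\<integral>\<^sup>+x. g x \<partial>Q))"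

lemma affinity_geD:
  assumes "affinity_ge M P Q \<rho>" "f \<in> borel_measurable M" "g \<in> borel_measurable M"
    "\<And>x. x \<in> space M \<Longrightarrow> 1 \<le> f x * g x"
  shows "ennreal (\<rho>\<^sup>2) \<le> (\<integral>\<^sup>+x. f x \<partial>P) * (\<integral>\<^sup>+x. g x \<partial>Q)"
  using assms unfolding affinity_ge_def by blast

text \<open>Admissible test functions vanish nowhere, so neither integral is 0; otherwise
  \<open>0 * \<top> = 0\<close> would spoil the case of an infinite factor.\<close>

lemma nn_integral_pos:
  fixes f :: "'y \<Rightarrow> ennreal"
  assumes P: "P \<in> space (prob_algebra M)" and f: "f \<in> borel_measurable M"
    and pos: "\<And>x. x \<in> space M \<Longrightarrow> f x \<noteq> 0"
  shows "(\<integral>\<^sup>+x. f x \<partial>P) \<noteq> 0"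
proof
  assume zero: "(\<integral>\<^sup>+x. f x \<partial>P) = 0"
  have sets: "sets P = sets M" and prob: "prob_space P"
    using P by (auto simp: space_prob_algebra)
  have fP: "f \<in> borel_measurable P"
    using f sets by (simp cong: measurable_cong_sets)
  have "AE x in P. f x = 0"
    using zero fP by (simp add: nn_integral_0_iff_AE)
  then have "AE x in P. False"
    using pos AE_space[of P] sets_eq_imp_space_eq[OF sets] by (auto elim!: AE_mp)
  then show False
    using prob_space.AE_False[OF prob] by simp
qed

text \<open>The constraint \<open>1 \<le> f * g\<close> survives replacing \<open>f\<close>,
  \<open>g\<close> by \<open>t * f\<close>, \<open>g / t\<close>. At \<open>t = sqrt (G / F)\<close>
  the sum of the two integrals is twice their geometric mean, so a bound on sums, which is linear
  and easier to prove, yields the bound on products.\<close>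

lemma affinity_geI:
  assumes P: "P \<in> space (prob_algebra M)" and Q: "Q \<in> space (prob_algebra M)" and \<rho>: "0 \<le> \<rho>"
    and add: "\<And>f g. f \<in> borel_measurable M \<Longrightarrow> g \<in> borel_measurable M \<Longrightarrow>
       (\<And>x. x \<in> space M \<Longrightarrow> 1 \<le> f x * g x) \<Longrightarrow>
       ennreal (2 * \<rho>) \<le> (\<integral>\<^sup>+x. f x \<partial>P) + (\<integral>\<^sup>+x. g x \<partial>Q)"
  shows "affinity_ge M P Q \<rho>"
  unfolding affinity_ge_def
proof (intro ballI impI)
  fix f g :: "'a \<Rightarrow> ennreal"
  assume f[measurable]: "f \<in> borel_measurable M" and g[measurable]: "g \<in> borel_measurable M"
    and fg: "\<forall>x\<in>space M. 1 \<le> f x * g x"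
  let ?F = "\<integral>\<^sup>+x. f x \<partial>P" and ?G = "\<integral>\<^sup>+x. g x \<partial>Q"
  have sets[measurable_cong]: "sets P = sets M" "sets Q = sets M"
    using P Q by (auto simp: space_prob_algebra)
  have F0: "?F \<noteq> 0" and G0: "?G \<noteq> 0"
    using fg by (intro nn_integral_pos[OF P f] nn_integral_pos[OF Q g]; force)+
  show "ennreal (\<rho>\<^sup>2) \<le> ?F * ?G"
  proof (cases "?F = \<top> \<or> ?G = \<top>")
    case True
    then show ?thesis using F0 G0 by (auto simp: ennreal_mult_top ennreal_top_mult)
  next
    case False
    define F G where "F = enn2real ?F" and "G = enn2real ?G"
    have FG: "?F = ennreal F" "?G = ennreal G"
      using False by (simp_all add: F_def G_def less_top)
    have pos: "F > 0" "G > 0"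
      using F0 G0 False by (auto simp: F_def G_def enn2real_positive_iff less_top zero_less_iff_neq_zero)
    define t where "t = sqrt (G / F)"
    have t: "t > 0" using pos by (simp add: t_def)
    have "ennreal (2 * \<rho>) \<le> (\<integral>\<^sup>+x. ennreal t * f x \<partial>P) + (\<integral>\<^sup>+x. ennreal (1 / t) * g x \<partial>Q)"
    proof (rule add)
      fix x assume "x \<in> space M"
      have "ennreal t * f x * (ennreal (1 / t) * g x) = (ennreal t * ennreal (1 / t)) * (f x * g x)"
        by (simp add: ac_simps)
      also have "ennreal t * ennreal (1 / t) = 1"
        using t by (simp flip: ennreal_mult)
      finally show "1 \<le> ennreal t * f x * (ennreal (1 / t) * g x)"
        using fg \<open>x \<in> space M\<close> by simp
    qed auto
    also have "\<dots> = ennreal t * ?F + ennreal (1 / t) * ?G"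
      by (simp add: nn_integral_cmult)
    also have "\<dots> = ennreal (t * F + 1 / t * G)"
      using t pos by (simp add: FG flip: ennreal_mult ennreal_plus)
    also have "t * F + 1 / t * G = 2 * sqrt (F * G)"
    proof -
      have "t * F = sqrt (F * G)" "1 / t * G = sqrt (F * G)"
        using pos by (auto simp: t_def real_sqrt_divide real_sqrt_mult field_simps)
      then show ?thesis by simp
    qed
    finally have "\<rho> \<le> sqrt (F * G)"
      using pos by simp
    then have "\<rho>\<^sup>2 \<le> F * G"
      using \<rho> pos by (metis real_sqrt_le_iff real_sqrt_pow2 power_mono mult_nonneg_nonneg less_imp_le)
    then show ?thesis
      using pos by (simp add: FG flip: ennreal_mult)
  qed
qed

text \<open>With \<open>l\<close> and \<open>l'\<close> read as roots of two densities, integrating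
  this pointwise inequality bounds the sum of the two test integrals below by twice the integral of
  \<open>l * l'\<close>.\<close>

lemma weighted_am_gm_ennreal:
  fixes f g :: ennreal and l l' :: real
  assumes fg: "1 \<le> f * g" and l: "0 \<le> l" "0 \<le> l'"
  shows "ennreal (2 * (l * l')) \<le> f * ennreal (l\<^sup>2) + g * ennreal (l'\<^sup>2)"
proof (cases "l = 0 \<or> l' = 0")
  case False
  then have pos: "l > 0" "l' > 0" using l by auto
  show ?thesis
  proof (cases "f = \<top> \<or> g = \<top>")
    case True
    then show ?thesis using pos by (auto simp: ennreal_top_mult)
  next
    case False
    then obtain a b where ab: "f = ennreal a" "g = ennreal b" "0 \<le> a" "0 \<le> b"
      by (metis ennreal_cases)
    have "1 \<le> a * b"
      using fg by (simp add: ab flip: ennreal_mult ennreal_1)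
    then have "1 \<le> sqrt a * sqrt b"
      using real_sqrt_le_mono[of 1 "a * b"] by (simp add: real_sqrt_mult)
    then have "2 * (l * l') * 1 \<le> 2 * (l * l') * (sqrt a * sqrt b)"
      using pos by (intro mult_left_mono) auto
    also have "\<dots> \<le> (sqrt a * l)\<^sup>2 + (sqrt b * l')\<^sup>2"
      using sum_squares_bound[of "sqrt a * l" "sqrt b * l'"] by (simp add: ac_simps)
    also have "\<dots> = a * l\<^sup>2 + b * l'\<^sup>2"
      using ab by (simp add: power_mult_distrib)
    finally show ?thesis
      using ab by (simp flip: ennreal_mult ennreal_plus)
  qed
qed auto

text \<open>Needed for laws shared by both parameters: the fibres of a Markov kernel and the action
  drawn by a policy given the past cost no affinity.\<close>

lemma affinity_ge_refl:
  assumes "P \<in> space (prob_algebra M)"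
  shows "affinity_ge M P P 1"
proof (rule affinity_geI[OF assms assms])
  fix f g :: "'a \<Rightarrow> ennreal"
  assume f[measurable]: "f \<in> borel_measurable M" and g[measurable]: "g \<in> borel_measurable M"
    and fg: "\<And>x. x \<in> space M \<Longrightarrow> 1 \<le> f x * g x"
  have sets[measurable_cong]: "sets P = sets M" and prob: "prob_space P"
    using assms by (auto simp: space_prob_algebra)
  have "ennreal (2 * 1) = (\<integral>\<^sup>+x. 2 \<partial>P)"
    using prob_space.emeasure_space_1[OF prob] by simp
  also have "\<dots> \<le> (\<integral>\<^sup>+x. f x + g x \<partial>P)"
    using weighted_am_gm_ennreal[of _ _ 1 1, OF fg] sets_eq_imp_space_eq[OF sets]
    by (intro nn_integral_mono) simp
  also have "\<dots> = (\<integral>\<^sup>+x. f x \<partial>P) + (\<integral>\<^sup>+x. g x \<partial>P)"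
    by (rule nn_integral_add) auto
  finally show "ennreal (2 * 1) \<le> (\<integral>\<^sup>+x. f x \<partial>P) + (\<integral>\<^sup>+x. g x \<partial>P)" .
qed simp

text \<open>By homogeneity: one test function is divided by \<open>c\<close>. Here \<open>c\<close>
  stands for what an inner integration has already contributed, so that the bounds of successive
  stages multiply.\<close>

lemma affinity_geD_ge:
  assumes aff: "affinity_ge M P Q \<rho>" and [measurable]: "f \<in> borel_measurable M" "g \<in> borel_measurable M"
    and sets[measurable_cong]: "sets Q = sets M"
    and fg: "\<And>x. x \<in> space M \<Longrightarrow> ennreal c \<le> f x * g x" and c: "0 < c"
  shows "ennreal (c * \<rho>\<^sup>2) \<le> (\<integral>\<^sup>+x. f x \<partial>P) * (\<integral>\<^sup>+x. g x \<partial>Q)"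
proof -
  have unit: "ennreal c * ennreal (1 / c) = 1"
    using c by (simp flip: ennreal_mult)
  have "ennreal (\<rho>\<^sup>2) \<le> (\<integral>\<^sup>+x. f x \<partial>P) * (\<integral>\<^sup>+x. ennreal (1 / c) * g x \<partial>Q)"
  proof (rule affinity_geD[OF aff])
    fix x assume "x \<in> space M"
    have "1 = ennreal c * ennreal (1 / c)" using unit by simp
    also have "\<dots> \<le> f x * g x * ennreal (1 / c)"
      using fg[OF \<open>x \<in> space M\<close>] by (intro mult_right_mono) auto
    finally show "1 \<le> f x * (ennreal (1 / c) * g x)" by (simp add: ac_simps)
  qed auto
  then have "ennreal c * ennreal (\<rho>\<^sup>2) \<le> ennreal c * ((\<integral>\<^sup>+x. f x \<partial>P) * (\<integral>\<^sup>+x. ennreal (1 / c) * g x \<partial>Q))"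
    by (intro mult_left_mono) auto
  also have "\<dots> = (ennreal c * ennreal (1 / c)) * ((\<integral>\<^sup>+x. f x \<partial>P) * (\<integral>\<^sup>+x. g x \<partial>Q))"
    by (subst nn_integral_cmult) (auto simp: ac_simps)
  finally show ?thesis
    using c by (simp add: unit flip: ennreal_mult)
qed

text \<open>Test functions on \<open>N\<close> are pulled back by integrating them against
  \<open>K x\<close>. The pulled-back pair is admissible because both fibres are the same law, whose
  affinity with itself is 1. No density of the image laws is involved.\<close>

lemma affinity_ge_bind:
  assumes aff: "affinity_ge M P Q \<rho>" and P: "P \<in> space (prob_algebra M)" "Q \<in> space (prob_algebra M)"
    and K: "K \<in> M \<rightarrow>\<^sub>M prob_algebra N"
  shows "affinity_ge N (P \<bind> K) (Q \<bind> K) \<rho>"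
  unfolding affinity_ge_def
proof (intro ballI impI)
  fix f g :: "'b \<Rightarrow> ennreal"
  assume f: "f \<in> borel_measurable N" and g: "g \<in> borel_measurable N"
    and fg: "\<forall>x\<in>space N. 1 \<le> f x * g x"
  have sets: "sets P = sets M" "sets Q = sets M"
    using P by (auto simp: space_prob_algebra)
  have K': "K \<in> M \<rightarrow>\<^sub>M subprob_algebra N"
    using K by (rule measurable_prob_algebraD)
  have KP: "K \<in> P \<rightarrow>\<^sub>M subprob_algebra N" "K \<in> Q \<rightarrow>\<^sub>M subprob_algebra N"
    using K' sets by (simp_all cong: measurable_cong_sets)
  have bind: "(\<integral>\<^sup>+x. f x \<partial>(P \<bind> K)) = (\<integral>\<^sup>+x. \<integral>\<^sup>+y. f y \<partial>K x \<partial>P)"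
       "(\<integral>\<^sup>+x. g x \<partial>(Q \<bind> K)) = (\<integral>\<^sup>+x. \<integral>\<^sup>+y. g y \<partial>K x \<partial>Q)"
    by (rule nn_integral_bind[OF f KP(1)], rule nn_integral_bind[OF g KP(2)])
  have "ennreal (1 * \<rho>\<^sup>2) \<le> (\<integral>\<^sup>+x. \<integral>\<^sup>+y. f y \<partial>K x \<partial>P) * (\<integral>\<^sup>+x. \<integral>\<^sup>+y. g y \<partial>K x \<partial>Q)"
  proof (rule affinity_geD_ge[OF aff])
    show "(\<lambda>x. \<integral>\<^sup>+y. f y \<partial>K x) \<in> borel_measurable M"
      by (rule measurable_compose[OF K' nn_integral_measurable_subprob_algebra[OF f]])
    show "(\<lambda>x. \<integral>\<^sup>+y. g y \<partial>K x) \<in> borel_measurable M"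
      by (rule measurable_compose[OF K' nn_integral_measurable_subprob_algebra[OF g]])
    fix x assume "x \<in> space M"
    then have "affinity_ge N (K x) (K x) 1"
      using measurable_space[OF K] by (intro affinity_ge_refl) auto
    from affinity_geD[OF this f g] fg
    show "ennreal 1 \<le> (\<integral>\<^sup>+y. f y \<partial>K x) * (\<integral>\<^sup>+y. g y \<partial>K x)"
      by simp
  qed (use sets in auto)
  then show "ennreal (\<rho>\<^sup>2) \<le> (\<integral>\<^sup>+x. f x \<partial>(P \<bind> K)) * (\<integral>\<^sup>+x. g x \<partial>(Q \<bind> K))"
    by (simp add: bind)
qed

section \<open>Records of adaptive policies\<close>

lemma measurable_stage:
  assumes "a \<in> V"
  shows "Pair a \<in> Y a \<rightarrow>\<^sub>M stage_space Y V"
  unfolding stage_space_def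
proof (rule measurable_measure_of)
  show "{{a} \<times> B |a B. a \<in> V \<and> B \<in> sets (Y a)} \<subseteq> Pow (SIGMA a:V. space (Y a))"
    by (auto dest: sets.sets_into_space)
  fix A assume "A \<in> {{a} \<times> B |a B. a \<in> V \<and> B \<in> sets (Y a)}"
  then obtain a' B where A: "A = {a'} \<times> B" "B \<in> sets (Y a')" by auto
  have "Pair a -` A \<inter> space (Y a) = (if a = a' then B else {})"
    using sets.sets_into_space[OF A(2)] A(1) by auto
  then show "Pair a -` A \<inter> space (Y a) \<in> sets (Y a)"
    using A by auto
qed (use assms in auto)

lemma measurable_record_update:
  assumes a: "a \<in> V"
  shows "(\<lambda>(w, y). w(i := (a, y))) \<in> record_space Y V i \<Otimes>\<^sub>M Y a \<rightarrow>\<^sub>M record_space Y V (Suc i)"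
proof -
  have "(\<lambda>p. (\<lambda>(f, y). f(i := y)) (fst p, (a, snd p)))
      \<in> record_space Y V i \<Otimes>\<^sub>M Y a \<rightarrow>\<^sub>M PiM (insert i {..<i}) (\<lambda>_. stage_space Y V)"
    unfolding record_space_def
    by (rule measurable_compose[OF measurable_Pair measurable_add_dim])
      (rule measurable_fst measurable_compose[OF measurable_snd measurable_stage[OF a]])+
  then show ?thesis
    by (simp add: record_space_def lessThan_Suc split_beta')
qed

lemma measurable_record_update_return:
  assumes "a \<in> V"
  shows "(\<lambda>(w, y). return (record_space Y V (Suc i)) (w(i := (a, y))))
     \<in> record_space Y V i \<Otimes>\<^sub>M Y a \<rightarrow>\<^sub>M prob_algebra (record_space Y V (Suc i))"
  using measurable_compose[OF measurable_record_update[OF assms] measurable_return_prob_space]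
  by (simp add: split_beta')

text \<open>The sample space changes with the action, so measurability is checked for each action
  separately; this suffices because the finite menu is a countable discrete factor. The swap only
  brings that factor to the front.\<close>

lemma measurable_action_kernel:
  assumes V: "finite V" and F: "\<And>a. a \<in> V \<Longrightarrow> F a \<in> space (prob_algebra (Y a))"
  shows "(\<lambda>(w, a). F a \<bind> (\<lambda>y. return (record_space Y V (Suc i)) (w(i := (a, y)))))
     \<in> record_space Y V i \<Otimes>\<^sub>M count_space V \<rightarrow>\<^sub>M prob_algebra (record_space Y V (Suc i))"
proof (subst measurable_pair_swap_iff, rule measurable_pair_measure_countable1)
  fix a assume "a \<in> V"
  then show "(\<lambda>w. (\<lambda>(x, y). (\<lambda>(w, a). F a \<bind> (\<lambda>y. return (record_space Y V (Suc i)) (w(i := (a, y))))) (y, x)) (a, w))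
      \<in> record_space Y V i \<rightarrow>\<^sub>M prob_algebra (record_space Y V (Suc i))"
    by (simp, intro measurable_bind_prob_space2[where N="Y a"] measurable_const F measurable_record_update_return)
qed (use V in \<open>simp add: countable_finite\<close>)

lemma measurable_policy_kernel:
  assumes V: "finite V" and F: "\<And>a. a \<in> V \<Longrightarrow> F a \<in> space (prob_algebra (Y a))"
    and \<pi>: "\<pi> \<in> menu_policies Y V n" and i: "i < n"
  shows "(\<lambda>w. \<pi> i w \<bind> (\<lambda>a. F a \<bind> (\<lambda>y. return (record_space Y V (Suc i)) (w(i := (a, y))))))
     \<in> record_space Y V i \<rightarrow>\<^sub>M prob_algebra (record_space Y V (Suc i))"
  using \<pi> i unfolding menu_policies_def
  by (intro measurable_bind_prob_space2[OF _ measurable_action_kernel[OF V F]]) auto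

lemma record_law_in_prob_algebra:
  assumes V: "finite V" and F: "\<And>a. a \<in> V \<Longrightarrow> F a \<in> space (prob_algebra (Y a))"
    and \<pi>: "\<pi> \<in> menu_policies Y V n" and i: "i \<le> n"
  shows "record_law Y V \<pi> F i \<in> space (prob_algebra (record_space Y V i))"
  using i
proof (induction i)
  case 0
  then show ?case
    by (auto simp: space_prob_algebra record_space_def space_PiM intro!: prob_space_return)
next
  case (Suc i)
  then have "record_law Y V \<pi> F i \<in> space (prob_algebra (record_space Y V i))" by simp
  moreover note measurable_policy_kernel[OF V F \<pi>, of i]
  ultimately show ?case
    using Suc by (simp add: space_prob_algebra prob_space_bind' sets_bind')
qed

text \<open>Peels off the last stage as past, action, outcome. The inner integrals come with their
  measurability so that they can serve as test functions on the shorter record.\<close>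

lemma nn_integral_record_law_Suc:
  assumes V: "finite V" and F: "\<And>a. a \<in> V \<Longrightarrow> F a \<in> space (prob_algebra (Y a))"
    and \<pi>: "\<pi> \<in> menu_policies Y V n" and i: "i < n"
    and f: "f \<in> borel_measurable (record_space Y V (Suc i))"
  shows "(\<integral>\<^sup>+w. f w \<partial>record_law Y V \<pi> F (Suc i)) =
     (\<integral>\<^sup>+w. \<integral>\<^sup>+a. \<integral>\<^sup>+y. f (w(i := (a, y))) \<partial>F a \<partial>\<pi> i w \<partial>record_law Y V \<pi> F i)"
    and "a \<in> V \<Longrightarrow> (\<lambda>w. \<integral>\<^sup>+y. f (w(i := (a, y))) \<partial>F a) \<in> borel_measurable (record_space Y V i)"
    and "(\<lambda>w. \<integral>\<^sup>+a. \<integral>\<^sup>+y. f (w(i := (a, y))) \<partial>F a \<partial>\<pi> i w) \<in> borel_measurable (record_space Y V i)"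
proof -
  let ?G = "\<lambda>w a. F a \<bind> (\<lambda>y. return (record_space Y V (Suc i)) (w(i := (a, y))))"
  have R: "sets (record_law Y V \<pi> F i) = sets (record_space Y V i)"
    using record_law_in_prob_algebra[OF V F \<pi>, of i] i by (simp add: space_prob_algebra)
  note spR = sets_eq_imp_space_eq[OF R]
  have \<pi>i: "\<pi> i \<in> record_space Y V i \<rightarrow>\<^sub>M prob_algebra (count_space V)"
    using \<pi> i by (auto simp: menu_policies_def)
  have set\<pi>: "sets (\<pi> i w) = sets (count_space V)" if "w \<in> space (record_space Y V i)" for w
    using measurable_space[OF \<pi>i that] by (simp add: space_prob_algebra)
  have upd: "(\<lambda>y. w(i := (a, y))) \<in> Y a \<rightarrow>\<^sub>M record_space Y V (Suc i)"
    if "w \<in> space (record_space Y V i)" "a \<in> V" for w a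
    using measurable_Pair2[OF measurable_record_update[OF that(2)] that(1)] by simp
  have inner: "(\<integral>\<^sup>+x. f x \<partial>?G w a) = (\<integral>\<^sup>+y. f (w(i := (a, y))) \<partial>F a)"
    if w: "w \<in> space (record_space Y V i)" and a: "a \<in> V" for w a
  proof -
    have setF: "sets (F a) = sets (Y a)" using F[OF a] by (simp add: space_prob_algebra)
    have "(\<lambda>y. return (record_space Y V (Suc i)) (w(i := (a, y))))
       \<in> F a \<rightarrow>\<^sub>M subprob_algebra (record_space Y V (Suc i))"
      using measurable_compose[OF upd[OF w a] return_measurable] setF
      by (simp cong: measurable_cong_sets)
    from nn_integral_bind[OF f this]
    have "(\<integral>\<^sup>+x. f x \<partial>?G w a) =
        (\<integral>\<^sup>+y. \<integral>\<^sup>+x. f x \<partial>return (record_space Y V (Suc i)) (w(i := (a, y))) \<partial>F a)" .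
    also have "\<dots> = (\<integral>\<^sup>+y. f (w(i := (a, y))) \<partial>F a)"
      using measurable_space[OF upd[OF w a]] sets_eq_imp_space_eq[OF setF]
      by (intro nn_integral_cong nn_integral_return) (auto simp: f)
    finally show ?thesis .
  qed
  have middle: "(\<integral>\<^sup>+x. f x \<partial>(\<pi> i w \<bind> ?G w)) = (\<integral>\<^sup>+a. \<integral>\<^sup>+y. f (w(i := (a, y))) \<partial>F a \<partial>\<pi> i w)"
    if w: "w \<in> space (record_space Y V i)" for w
  proof -
    have "?G w \<in> count_space V \<rightarrow>\<^sub>M prob_algebra (record_space Y V (Suc i))"
      using measurable_Pair2[OF measurable_action_kernel[OF V F] w] by simp
    from measurable_prob_algebraD[OF this]
    have "?G w \<in> \<pi> i w \<rightarrow>\<^sub>M subprob_algebra (record_space Y V (Suc i))"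
      by (subst measurable_cong_sets[OF set\<pi>[OF w] refl])
    from nn_integral_bind[OF f this]
    have "(\<integral>\<^sup>+x. f x \<partial>(\<pi> i w \<bind> ?G w)) = (\<integral>\<^sup>+a. \<integral>\<^sup>+x. f x \<partial>?G w a \<partial>\<pi> i w)" .
    also have "\<dots> = (\<integral>\<^sup>+a. \<integral>\<^sup>+y. f (w(i := (a, y))) \<partial>F a \<partial>\<pi> i w)"
      using sets_eq_imp_space_eq[OF set\<pi>[OF w]]
      by (intro nn_integral_cong inner[OF w]) simp
    finally show ?thesis .
  qed
  have K: "(\<lambda>w. \<pi> i w \<bind> ?G w) \<in> record_space Y V i \<rightarrow>\<^sub>M subprob_algebra (record_space Y V (Suc i))"
    by (rule measurable_prob_algebraD[OF measurable_policy_kernel[OF V F \<pi> i]])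
  then have KR: "(\<lambda>w. \<pi> i w \<bind> ?G w) \<in> record_law Y V \<pi> F i \<rightarrow>\<^sub>M subprob_algebra (record_space Y V (Suc i))"
    using R by (simp cong: measurable_cong_sets)
  have "(\<integral>\<^sup>+w. f w \<partial>record_law Y V \<pi> F (Suc i)) = (\<integral>\<^sup>+w. \<integral>\<^sup>+x. f x \<partial>(\<pi> i w \<bind> ?G w) \<partial>record_law Y V \<pi> F i)"
    unfolding record_law.simps by (rule nn_integral_bind[OF f KR])
  also have "\<dots> = (\<integral>\<^sup>+w. \<integral>\<^sup>+a. \<integral>\<^sup>+y. f (w(i := (a, y))) \<partial>F a \<partial>\<pi> i w \<partial>record_law Y V \<pi> F i)"
    by (intro nn_integral_cong middle) (simp add: spR)
  finally show "(\<integral>\<^sup>+w. f w \<partial>record_law Y V \<pi> F (Suc i)) =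
     (\<integral>\<^sup>+w. \<integral>\<^sup>+a. \<integral>\<^sup>+y. f (w(i := (a, y))) \<partial>F a \<partial>\<pi> i w \<partial>record_law Y V \<pi> F i)" .
  have "(\<lambda>w. \<integral>\<^sup>+x. f x \<partial>(\<pi> i w \<bind> ?G w)) \<in> borel_measurable (record_space Y V i)"
    by (rule measurable_compose[OF K nn_integral_measurable_subprob_algebra[OF f]])
  then show "(\<lambda>w. \<integral>\<^sup>+a. \<integral>\<^sup>+y. f (w(i := (a, y))) \<partial>F a \<partial>\<pi> i w) \<in> borel_measurable (record_space Y V i)"
    by (subst (asm) measurable_cong[OF middle]) auto
  show "(\<lambda>w. \<integral>\<^sup>+y. f (w(i := (a, y))) \<partial>F a) \<in> borel_measurable (record_space Y V i)" if a: "a \<in> V"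
  proof -
    have "(\<lambda>w. ?G w a) \<in> record_space Y V i \<rightarrow>\<^sub>M subprob_algebra (record_space Y V (Suc i))"
      using measurable_Pair1[OF measurable_prob_algebraD[OF measurable_action_kernel[OF V F]]] a by simp
    then have "(\<lambda>w. \<integral>\<^sup>+x. f x \<partial>?G w a) \<in> borel_measurable (record_space Y V i)"
      by (rule measurable_compose[OF _ nn_integral_measurable_subprob_algebra[OF f]])
    then show ?thesis
      by (subst (asm) measurable_cong[OF inner]) (auto simp: a)
  qed
qed

text \<open>Integrating out the last outcome leaves a product of at least
  \<open>\<rho>\<^sup>2\<close> whichever action was taken; averaging over the action preserves
  this, since both laws use the same \<open>\<pi> i w\<close>; the earlier stages contribute by the
  induction hypothesis. The common \<rho> for all actions is what makes adaptivity harmless.\<close>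

lemma affinity_ge_record_law:
  assumes V: "finite V"
    and F: "\<And>a. a \<in> V \<Longrightarrow> F a \<in> space (prob_algebra (Y a))"
    and F': "\<And>a. a \<in> V \<Longrightarrow> F' a \<in> space (prob_algebra (Y a))"
    and aff: "\<And>a. a \<in> V \<Longrightarrow> affinity_ge (Y a) (F a) (F' a) \<rho>" and \<rho>: "0 < \<rho>"
    and \<pi>: "\<pi> \<in> menu_policies Y V n" and i: "i \<le> n"
  shows "affinity_ge (record_space Y V i) (record_law Y V \<pi> F i) (record_law Y V \<pi> F' i) (\<rho> ^ i)"
  using i
proof (induction i)
  case 0
  show ?case
    using affinity_ge_refl[OF record_law_in_prob_algebra[OF V F \<pi>, of 0]] by simp
next
  case (Suc i)
  then have i: "i < n" by simp
  have R': "sets (record_law Y V \<pi> F' i) = sets (record_space Y V i)"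
    using record_law_in_prob_algebra[OF V F' \<pi>, of i] i by (simp add: space_prob_algebra)
  have \<pi>i: "\<pi> i \<in> record_space Y V i \<rightarrow>\<^sub>M prob_algebra (count_space V)"
    using \<pi> i by (auto simp: menu_policies_def)
  show ?case
    unfolding affinity_ge_def
  proof (intro ballI impI)
    fix f g :: "(nat \<Rightarrow> 'a \<times> 'b) \<Rightarrow> ennreal"
    assume f: "f \<in> borel_measurable (record_space Y V (Suc i))"
      and g: "g \<in> borel_measurable (record_space Y V (Suc i))"
      and fg: "\<forall>x\<in>space (record_space Y V (Suc i)). 1 \<le> f x * g x"
    let ?f = "\<lambda>w a. \<integral>\<^sup>+y. f (w(i := (a, y))) \<partial>F a" and ?g = "\<lambda>w a. \<integral>\<^sup>+y. g (w(i := (a, y))) \<partial>F' a"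
    note If = nn_integral_record_law_Suc[OF V F \<pi> i f] and Ig = nn_integral_record_law_Suc[OF V F' \<pi> i g]
    have "ennreal (\<rho>\<^sup>2 * (\<rho> ^ i)\<^sup>2)
       \<le> (\<integral>\<^sup>+w. \<integral>\<^sup>+a. ?f w a \<partial>\<pi> i w \<partial>record_law Y V \<pi> F i) * (\<integral>\<^sup>+w. \<integral>\<^sup>+a. ?g w a \<partial>\<pi> i w \<partial>record_law Y V \<pi> F' i)"
    proof (rule affinity_geD_ge[OF Suc.IH])
      fix w assume w: "w \<in> space (record_space Y V i)"
      have P: "\<pi> i w \<in> space (prob_algebra (count_space V))"
        by (rule measurable_space[OF \<pi>i w])
      then have "sets (\<pi> i w) = sets (count_space V)"
        by (simp add: space_prob_algebra)
      then have "ennreal (\<rho>\<^sup>2 * 1\<^sup>2) \<le> (\<integral>\<^sup>+a. ?f w a \<partial>\<pi> i w) * (\<integral>\<^sup>+a. ?g w a \<partial>\<pi> i w)"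
      proof (intro affinity_geD_ge[OF affinity_ge_refl[OF P]])
        fix a assume "a \<in> space (count_space V)"
        then have a: "a \<in> V" by simp
        have upd: "(\<lambda>y. w(i := (a, y))) \<in> Y a \<rightarrow>\<^sub>M record_space Y V (Suc i)"
          using measurable_Pair2[OF measurable_record_update[OF a] w] by simp
        show "ennreal (\<rho>\<^sup>2) \<le> ?f w a * ?g w a"
          using fg measurable_space[OF upd]
          by (intro affinity_geD[OF aff[OF a]] measurable_compose[OF upd f] measurable_compose[OF upd g]) auto
      qed (use \<rho> in auto)
      then show "ennreal (\<rho>\<^sup>2) \<le> (\<integral>\<^sup>+a. ?f w a \<partial>\<pi> i w) * (\<integral>\<^sup>+a. ?g w a \<partial>\<pi> i w)"
        by simp
    qed (use i \<rho> R' If(3) Ig(3) in auto)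
    also have "\<rho>\<^sup>2 * (\<rho> ^ i)\<^sup>2 = (\<rho> ^ Suc i)\<^sup>2"
      by (simp add: power_mult_distrib)
    finally show "ennreal ((\<rho> ^ Suc i)\<^sup>2)
        \<le> (\<integral>\<^sup>+x. f x \<partial>record_law Y V \<pi> F (Suc i)) * (\<integral>\<^sup>+x. g x \<partial>record_law Y V \<pi> F' (Suc i))"
      by (simp only: If(1) Ig(1))
  qed
qed

section \<open>A discrete van Trees inequality\<close>

text \<open>Young's inequality. For small \<eta> the term in \<open>x\<close> keeps a coefficient
  near 1, as long as \<open>y\<^sup>2\<close> is small compared with \<eta>.\<close>

lemma power2_sum_le_weighted:
  fixes x y \<eta> :: real
  assumes \<eta>: "0 < \<eta>"
  shows "(x + y)\<^sup>2 \<le> (1 + \<eta>) * x\<^sup>2 + (1 + 1 / \<eta>) * y\<^sup>2"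
proof -
  have "0 \<le> (sqrt \<eta> * x - y / sqrt \<eta>)\<^sup>2" by simp
  also have "\<dots> = \<eta> * x\<^sup>2 - 2 * x * y + y\<^sup>2 / \<eta>"
    using \<eta> by (simp add: power2_diff power_mult_distrib power_divide)
  finally show ?thesis
    by (simp add: power2_sum distrib_right)
qed

lemma shifted_square_moments:
  fixes T :: "'y \<Rightarrow> real"
  assumes P: "P \<in> space (prob_algebra M)" and T: "T \<in> borel_measurable M"
    and T2: "integrable P (\<lambda>x. (T x)\<^sup>2)"
  shows "integrable P T" "integrable P (\<lambda>x. (T x - c)\<^sup>2)"
    "(\<integral>x. (T x - c)\<^sup>2 \<partial>P) = (\<integral>x. (T x)\<^sup>2 \<partial>P) - 2 * c * (\<integral>x. T x \<partial>P) + c\<^sup>2"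
proof -
  interpret prob_space P using P by (simp add: space_prob_algebra)
  have "T \<in> borel_measurable P"
    using P T by (simp add: space_prob_algebra cong: measurable_cong_sets)
  then show iT: "integrable P T"
    using T2 by (rule square_integrable_imp_integrable)
  have eq: "(T x - c)\<^sup>2 = (T x)\<^sup>2 - 2 * c * T x + c\<^sup>2" for x
    by (simp add: power2_diff)
  show "integrable P (\<lambda>x. (T x - c)\<^sup>2)"
    unfolding eq using iT T2 by auto
  show "(\<integral>x. (T x - c)\<^sup>2 \<partial>P) = (\<integral>x. (T x)\<^sup>2 \<partial>P) - 2 * c * (\<integral>x. T x \<partial>P) + c\<^sup>2"
    unfolding eq using iT T2 by (simp add: prob_space)
qed

text \<open>Parallelogram identity. A law inside a chain belongs to two neighbouring pairs, with
  errors centred half a step to its left and right; together they give the error around its own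
  target.\<close>

lemma shifted_squares_midpoint:
  fixes T :: "'y \<Rightarrow> real"
  assumes P: "P \<in> space (prob_algebra M)" and T: "T \<in> borel_measurable M"
    and T2: "integrable P (\<lambda>x. (T x)\<^sup>2)"
  shows "(\<integral>x. (T x - (c - d))\<^sup>2 \<partial>P) + (\<integral>x. (T x - (c + d))\<^sup>2 \<partial>P) =
     2 * (\<integral>x. (T x - c)\<^sup>2 \<partial>P) + 2 * d\<^sup>2"
  unfolding shifted_square_moments(3)[OF assms, of c] shifted_square_moments(3)[OF assms, of "c - d"]
    shifted_square_moments(3)[OF assms, of "c + d"]
  by (simp add: power2_diff power2_sum algebra_simps)

text \<open>The integrand is \<open>((1 + u)\<^sup>2 + 1) / 2\<close> with
  \<open>u = \<kappa> * (T x - c)\<close>, hence nonnegative. The nonnegativity of the closed form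
  also bounds the two free ends of a chain of laws.\<close>

lemma nn_integral_quadratic_test:
  fixes T :: "'y \<Rightarrow> real"
  assumes P: "P \<in> space (prob_algebra M)" and T: "T \<in> borel_measurable M"
    and T2: "integrable P (\<lambda>x. (T x)\<^sup>2)"
  shows "(\<integral>\<^sup>+x. ennreal (1 + \<kappa> * (T x - c) + (\<kappa> * (T x - c))\<^sup>2 / 2) \<partial>P) =
      ennreal (1 + \<kappa> * ((\<integral>x. T x \<partial>P) - c) + \<kappa>\<^sup>2 / 2 * (\<integral>x. (T x - c)\<^sup>2 \<partial>P))"
    and "0 \<le> 1 + \<kappa> * ((\<integral>x. T x \<partial>P) - c) + \<kappa>\<^sup>2 / 2 * (\<integral>x. (T x - c)\<^sup>2 \<partial>P)"
proof -
  interpret prob_space P using P by (simp add: space_prob_algebra)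
  let ?f = "\<lambda>x. 1 + \<kappa> * (T x - c) + \<kappa>\<^sup>2 / 2 * (T x - c)\<^sup>2"
  note int = shifted_square_moments(1,2)[OF P T T2]
  have pos: "0 \<le> ?f x" for x
    using sum_squares_ge_zero[of "1 + \<kappa> * (T x - c)" 1] 
    by (simp add: power2_eq_square algebra_simps)
  have val: "(\<integral>x. ?f x \<partial>P) = 1 + \<kappa> * ((\<integral>x. T x \<partial>P) - c) + \<kappa>\<^sup>2 / 2 * (\<integral>x. (T x - c)\<^sup>2 \<partial>P)"
    using int(1) int(2)[of c] by (simp add: prob_space)
  have "(\<integral>\<^sup>+x. ennreal (?f x) \<partial>P) = ennreal (\<integral>x. ?f x \<partial>P)"
    using int(1) int(2)[of c] pos by (intro nn_integral_eq_integral) auto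
  then show "(\<integral>\<^sup>+x. ennreal (1 + \<kappa> * (T x - c) + (\<kappa> * (T x - c))\<^sup>2 / 2) \<partial>P) =
      ennreal (1 + \<kappa> * ((\<integral>x. T x \<partial>P) - c) + \<kappa>\<^sup>2 / 2 * (\<integral>x. (T x - c)\<^sup>2 \<partial>P))"
    unfolding val by (simp add: power_mult_distrib)
  have "0 \<le> (\<integral>x. ?f x \<partial>P)"
    using pos by simp
  then show "0 \<le> 1 + \<kappa> * ((\<integral>x. T x \<partial>P) - c) + \<kappa>\<^sup>2 / 2 * (\<integral>x. (T x - c)\<^sup>2 \<partial>P)"
    unfolding val .
qed

text \<open>\<open>exp u\<close> and \<open>exp (- u)\<close> would be the natural test pair; their
  second-order truncations keep the product at least 1 but ask only for second moments of
  \<open>T\<close>. The linear terms produce the difference of means, and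
  \<open>2 * \<rho> \<le> F + G\<close> follows from the arithmetic-geometric mean inequality. The
  centre \<open>c\<close> is free and will be a midpoint of two targets.\<close>

lemma affinity_mean_difference:
  fixes T :: "'y \<Rightarrow> real"
  assumes aff: "affinity_ge M P Q \<rho>" and \<rho>: "0 \<le> \<rho>"
    and P: "P \<in> space (prob_algebra M)" and Q: "Q \<in> space (prob_algebra M)"
    and T[measurable]: "T \<in> borel_measurable M"
    and TP: "integrable P (\<lambda>x. (T x)\<^sup>2)" and TQ: "integrable Q (\<lambda>x. (T x)\<^sup>2)"
  shows "\<kappa> * ((\<integral>x. T x \<partial>Q) - (\<integral>x. T x \<partial>P)) \<le>
     2 * (1 - \<rho>) + \<kappa>\<^sup>2 / 2 * ((\<integral>x. (T x - c)\<^sup>2 \<partial>P) + (\<integral>x. (T x - c)\<^sup>2 \<partial>Q))"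
proof -
  define F where "F = 1 + \<kappa> * ((\<integral>x. T x \<partial>P) - c) + \<kappa>\<^sup>2 / 2 * (\<integral>x. (T x - c)\<^sup>2 \<partial>P)"
  define G where "G = 1 + (- \<kappa>) * ((\<integral>x. T x \<partial>Q) - c) + (- \<kappa>)\<^sup>2 / 2 * (\<integral>x. (T x - c)\<^sup>2 \<partial>Q)"
  let ?u = "\<lambda>x. \<kappa> * (T x - c)"
  let ?f = "\<lambda>x. ennreal (1 + \<kappa> * (T x - c) + (\<kappa> * (T x - c))\<^sup>2 / 2)"
  let ?g = "\<lambda>x. ennreal (1 + (- \<kappa>) * (T x - c) + ((- \<kappa>) * (T x - c))\<^sup>2 / 2)"
  have F: "(\<integral>\<^sup>+x. ?f x \<partial>P) = ennreal F" "0 \<le> F"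
    unfolding F_def using nn_integral_quadratic_test[OF P T TP] by auto
  have G: "(\<integral>\<^sup>+x. ?g x \<partial>Q) = ennreal G" "0 \<le> G"
    unfolding G_def using nn_integral_quadratic_test[OF Q T TQ] by blast+
  have "ennreal (\<rho>\<^sup>2) \<le> (\<integral>\<^sup>+x. ?f x \<partial>P) * (\<integral>\<^sup>+x. ?g x \<partial>Q)"
  proof (rule affinity_geD[OF aff])
    fix x
    \<comment> \<open>the product is \<open>(1 + u\<^sup>2 / 2)\<^sup>2 - u\<^sup>2 = 1 + u ^ 4 / 4\<close>\<close>
    have prod: "(1 + u + u\<^sup>2 / 2) * (1 + (- u) + (- u)\<^sup>2 / 2) = 1 + (u\<^sup>2)\<^sup>2 / 4" for u :: real
      by (simp add: power2_eq_square algebra_simps)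
    have pos: "0 \<le> 1 + u + u\<^sup>2 / 2" for u :: real
      using sum_squares_ge_zero[of "1 + u" 1] by (simp add: power2_eq_square algebra_simps)
    have "1 \<le> (1 + ?u x + (?u x)\<^sup>2 / 2) * (1 + (- ?u x) + (- ?u x)\<^sup>2 / 2)"
      unfolding prod by simp
    then have "1 \<le> ennreal (1 + ?u x + (?u x)\<^sup>2 / 2) * ennreal (1 + (- ?u x) + (- ?u x)\<^sup>2 / 2)"
      using pos[of "?u x"] pos[of "- ?u x"] by (metis ennreal_mult ennreal_leI ennreal_1)
    then show "1 \<le> ?f x * ?g x" by simp
  qed auto
  then have FG: "\<rho>\<^sup>2 \<le> F * G"
    unfolding F(1) G(1) using F(2) G(2) by (simp flip: ennreal_mult)
  have "(2 * \<rho>)\<^sup>2 \<le> (F + G)\<^sup>2"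
    using FG sum_squares_bound[of F G] by (simp add: power2_eq_square algebra_simps)
  then have "2 * \<rho> \<le> F + G"
    using F(2) G(2) by (intro power2_le_imp_le[of "2 * \<rho>"]) auto
  then show ?thesis
    by (simp add: F_def G_def algebra_simps)
qed

text \<open>Links two consecutive estimates of a chain: \<open>A\<close> and \<open>B\<close> are
  the half-shifted errors of the law they share, \<open>D\<close> the recombined error.\<close>

lemma add_halves_combine:
  fixes x y :: real
  assumes "x \<le> a + k * (S + A)" "y \<le> b + k * (B + C)" "A + B = D"
  shows "x + y \<le> a + b + k * (S + D + C)"
  using assms(1,2) unfolding assms(3)[symmetric] by (simp add: distrib_left)

text \<open>The differences of neighbouring laws play the role of the score in the van Trees inequality for
  the uniform prior on an arithmetic progression; the affinity controls their size.\<close>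

lemma chain_mean_bound:
  fixes T :: "'y \<Rightarrow> real" and s \<beta> :: real
  defines "q \<equiv> \<lambda>R c. \<integral>x. (T x - c)\<^sup>2 \<partial>R"
  assumes R: "\<And>j. j \<le> n \<Longrightarrow> R j \<in> space (prob_algebra M)"
    and aff: "\<And>j. j < n \<Longrightarrow> affinity_ge M (R j) (R (Suc j)) \<rho>" and \<rho>: "0 \<le> \<rho>"
    and T: "T \<in> borel_measurable M" and T2: "\<And>j. j \<le> n \<Longrightarrow> integrable (R j) (\<lambda>x. (T x)\<^sup>2)"
  shows "\<kappa> * ((\<integral>x. T x \<partial>R n) - (s - \<beta> / 2)) \<le>
     1 + 2 * real n * (1 - \<rho>) + \<kappa>\<^sup>2 / 2 *
       ((\<Sum>j<n. 2 * q (R j) (s + \<beta> * j) + \<beta>\<^sup>2 / 2) + q (R n) (s + \<beta> * n - \<beta> / 2))"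
  using R aff T2
proof (induction n)
  case 0
  \<comment> \<open>The free left end: nonnegativity of the integrated test function centred half a
    step before the first target gives the summand 1.\<close>
  show ?case
    using nn_integral_quadratic_test(2)[OF 0(1)[of 0] T 0(3)[of 0], of "- \<kappa>" "s - \<beta> / 2"]
    by (simp add: q_def algebra_simps)
next
  case (Suc n)
  \<comment> \<open>Halfway between the targets of \<open>R n\<close> and \<open>R (Suc n)\<close>,
    so that the half-shifted errors of each inner law recombine around its own target.\<close>
  let ?c = "s + \<beta> * n + \<beta> / 2"
  have IH: "\<kappa> * ((\<integral>x. T x \<partial>R n) - (s - \<beta> / 2)) \<le>
     1 + 2 * real n * (1 - \<rho>) + \<kappa>\<^sup>2 / 2 *
       ((\<Sum>j<n. 2 * q (R j) (s + \<beta> * j) + \<beta>\<^sup>2 / 2) + q (R n) (s + \<beta> * n - \<beta> / 2))"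
    using Suc.prems by (intro Suc.IH) auto
  have step: "\<kappa> * ((\<integral>x. T x \<partial>R (Suc n)) - (\<integral>x. T x \<partial>R n)) \<le>
     2 * (1 - \<rho>) + \<kappa>\<^sup>2 / 2 * (q (R n) ?c + q (R (Suc n)) ?c)"
    unfolding q_def using Suc.prems T \<rho>
    by (intro affinity_mean_difference[where M=M]) auto
  have q: "q (R n) (s + \<beta> * n - \<beta> / 2) + q (R n) ?c = 2 * q (R n) (s + \<beta> * n) + \<beta>\<^sup>2 / 2"
    unfolding q_def using shifted_squares_midpoint[OF Suc.prems(1) T Suc.prems(3), of n "s + \<beta> * n" "\<beta> / 2"]
    by (simp add: power_divide)
  have c: "?c = s + \<beta> * Suc n - \<beta> / 2"
    by (simp add: algebra_simps)
  have lhs: "\<kappa> * ((\<integral>x. T x \<partial>R (Suc n)) - (s - \<beta> / 2)) =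
     \<kappa> * ((\<integral>x. T x \<partial>R n) - (s - \<beta> / 2)) + \<kappa> * ((\<integral>x. T x \<partial>R (Suc n)) - (\<integral>x. T x \<partial>R n))"
    by (simp add: algebra_simps)
  have "1 + 2 * real (Suc n) * (1 - \<rho>) = (1 + 2 * real n * (1 - \<rho>)) + 2 * (1 - \<rho>)"
    by (simp add: algebra_simps)
  then show ?case
    using add_halves_combine[OF IH step q] unfolding lhs c by (simp add: add.assoc)
qed

text \<open>Closing the chain half a step beyond the last target cancels all means and leaves
  \<open>\<kappa> * \<beta> * N\<close>. The term \<open>8 / N\<close> is the price of the two free
  ends, the counterpart of the prior information; \<open>8 * (1 - \<rho>)\<close> is the counterpart
  of the Fisher information over one step; \<open>\<beta>\<^sup>2 / 4\<close> is the discretisation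
  error of the midpoints.\<close>

lemma chain_risk_bound:
  fixes T :: "'y \<Rightarrow> real" and s \<beta> :: real
  assumes N: "0 < N"
    and R: "\<And>j. j < N \<Longrightarrow> R j \<in> space (prob_algebra M)"
    and aff: "\<And>j. Suc j < N \<Longrightarrow> affinity_ge M (R j) (R (Suc j)) \<rho>" and \<rho>: "0 \<le> \<rho>" "\<rho> \<le> 1"
    and T: "T \<in> borel_measurable M" and T2: "\<And>j. j < N \<Longrightarrow> integrable (R j) (\<lambda>x. (T x)\<^sup>2)"
    and X: "\<And>j. j < N \<Longrightarrow> (\<integral>x. (T x - (s + \<beta> * j))\<^sup>2 \<partial>R j) \<le> X"
  shows "\<beta>\<^sup>2 \<le> (8 / N + 8 * (1 - \<rho>)) * (X + \<beta>\<^sup>2 / 4)"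
proof -
  define q where "q = (\<lambda>R c. \<integral>x. (T x - c)\<^sup>2 \<partial>R)"
  obtain n where n: "N = Suc n" using N by (cases N) auto
  have "0 \<le> X"
    using X[of 0] N by (intro order_trans[OF _ X[of 0]]) auto
  define Z where "Z = X + \<beta>\<^sup>2 / 4"
  have bound: "\<kappa> * \<beta> * N \<le> 2 + 2 * N * (1 - \<rho>) + \<kappa>\<^sup>2 * N * Z" for \<kappa> :: real
  proof -
    let ?m = "\<integral>x. T x \<partial>R n" and ?c = "s + \<beta> * n + \<beta> / 2"
    let ?S = "\<Sum>j<n. 2 * q (R j) (s + \<beta> * j) + \<beta>\<^sup>2 / 2"
    have lower: "\<kappa> * (?m - (s - \<beta> / 2)) \<le>
       1 + 2 * real n * (1 - \<rho>) + \<kappa>\<^sup>2 / 2 * (?S + q (R n) (s + \<beta> * n - \<beta> / 2))"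
      unfolding q_def using n R aff \<rho> T T2 by (intro chain_mean_bound[where M=M]) auto
    have "0 \<le> 1 + \<kappa> * (?m - ?c) + \<kappa>\<^sup>2 / 2 * q (R n) ?c"
      unfolding q_def using n R T T2 by (intro nn_integral_quadratic_test(2)[where M=M]) auto
    then have upper: "\<kappa> * (?c - ?m) \<le> 1 + \<kappa>\<^sup>2 / 2 * (q (R n) ?c + 0)"
      by (simp add: right_diff_distrib)
    have "q (R n) (s + \<beta> * n - \<beta> / 2) + q (R n) ?c = 2 * q (R n) (s + \<beta> * n) + \<beta>\<^sup>2 / 2"
      unfolding q_def using shifted_squares_midpoint[OF R T T2, of n "s + \<beta> * n" "\<beta> / 2"] n
      by (simp add: power_divide)
    note add_halves_combine[OF lower upper this]
    moreover have "\<kappa> * (?m - (s - \<beta> / 2)) + \<kappa> * (?c - ?m) = \<kappa> * \<beta> * N"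
      unfolding n by (simp add: algebra_simps)
    moreover have "?S + (2 * q (R n) (s + \<beta> * n) + \<beta>\<^sup>2 / 2) + 0 = (\<Sum>j<N. 2 * q (R j) (s + \<beta> * j) + \<beta>\<^sup>2 / 2)"
      unfolding n by simp
    ultimately have "\<kappa> * \<beta> * N \<le> 1 + 2 * real n * (1 - \<rho>) + 1
        + \<kappa>\<^sup>2 / 2 * (\<Sum>j<N. 2 * q (R j) (s + \<beta> * j) + \<beta>\<^sup>2 / 2)"
      by simp
    also have "\<dots> = 2 + 2 * real n * (1 - \<rho>) + \<kappa>\<^sup>2 / 2 * (\<Sum>j<N. 2 * q (R j) (s + \<beta> * j) + \<beta>\<^sup>2 / 2)"
      by simp
    also have "\<dots> \<le> 2 + 2 * N * (1 - \<rho>) + \<kappa>\<^sup>2 / 2 * (\<Sum>j<N. 2 * X + \<beta>\<^sup>2 / 2)"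
      using X \<rho> n unfolding q_def by (intro add_mono mult_mono mult_left_mono sum_mono order_refl) auto
    finally show ?thesis
      by (simp add: Z_def algebra_simps)
  qed
  show ?thesis
  proof (cases "\<beta> = 0")
    case True
    then show ?thesis using \<open>0 \<le> X\<close> \<rho> by simp
  next
    case False
    then have Z: "0 < Z" using \<open>0 \<le> X\<close> by (auto simp: Z_def intro: add_nonneg_pos)
    \<comment> \<open>The maximiser of
      \<open>\<kappa> * \<beta> * N - \<kappa>\<^sup>2 * N * Z\<close>.\<close>
    define \<kappa> where "\<kappa> = \<beta> / (2 * Z)"
    have "\<kappa> * \<beta> * N \<le> 2 + 2 * N * (1 - \<rho>) + \<kappa>\<^sup>2 * N * Z" by (rule bound)
    moreover have "\<kappa> * \<beta> * N = 2 * (\<beta>\<^sup>2 / (4 * Z) * N)" "\<kappa>\<^sup>2 * N * Z = \<beta>\<^sup>2 / (4 * Z) * N"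
      using Z by (auto simp: \<kappa>_def power2_eq_square field_simps)
    ultimately have "\<beta>\<^sup>2 / (4 * Z) * N \<le> 2 + 2 * N * (1 - \<rho>)"
      by linarith
    then have "\<beta>\<^sup>2 / (4 * Z) \<le> 2 / N + 2 * (1 - \<rho>)"
      using N by (simp add: field_simps)
    then have "\<beta>\<^sup>2 \<le> (2 / N + 2 * (1 - \<rho>)) * (4 * Z)"
      using Z by (subst (asm) pos_divide_le_eq) auto
    then show ?thesis by (simp add: Z_def algebra_simps)
  qed
qed

text \<open>Replaces the local target \<open>t\<close> by its linearisation \<open>s\<close>:
  Young's inequality with weight \<eta> costs
  \<open>(1 + 1 / \<eta>) * \<eta>\<^sup>2 = \<eta>\<^sup>2 + \<eta>\<close>, which vanishes with
  \<eta>. Finite risk also supplies the square integrability that the chain bound asks of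
  \<open>T\<close>.\<close>

lemma target_perturbation:
  fixes T :: "'y \<Rightarrow> real"
  assumes P: "P \<in> space (prob_algebra M)" and T: "T \<in> borel_measurable M"
    and x: "(\<integral>\<^sup>+w. ennreal ((T w - t)\<^sup>2) \<partial>P) \<le> ennreal x" "0 \<le> x"
    and \<eta>: "0 < \<eta>" and s: "\<bar>t - s\<bar> \<le> \<eta>"
  shows "integrable P (\<lambda>w. (T w)\<^sup>2)" and "(\<integral>w. (T w - s)\<^sup>2 \<partial>P) \<le> (1 + \<eta>) * x + \<eta>\<^sup>2 + \<eta>"
proof -
  interpret prob_space P using P by (simp add: space_prob_algebra)
  have TP[measurable]: "T \<in> borel_measurable P"
    using P T by (simp add: space_prob_algebra cong: measurable_cong_sets)
  have i2: "integrable P (\<lambda>w. (T w - t)\<^sup>2)"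
    using le_less_trans[OF x(1) ennreal_less_top] by (intro integrableI_nonneg) auto
  then have i1: "integrable P (\<lambda>w. T w - t)"
    by (rule square_integrable_imp_integrable[rotated]) auto
  have "integrable P (\<lambda>w. (T w - t)\<^sup>2 + 2 * t * (T w - t) + t\<^sup>2)"
    using i1 i2 by simp
  also have "(\<lambda>w. (T w - t)\<^sup>2 + 2 * t * (T w - t) + t\<^sup>2) = (\<lambda>w. (T w)\<^sup>2)"
    by (simp add: fun_eq_iff power2_eq_square algebra_simps)
  finally show T2: "integrable P (\<lambda>w. (T w)\<^sup>2)" .
  have "(\<integral>w. (T w - t)\<^sup>2 \<partial>P) \<le> x"
    using x i2 by (subst (asm) nn_integral_eq_integral) auto
  have "(\<integral>w. (T w - s)\<^sup>2 \<partial>P) \<le> (\<integral>w. (1 + \<eta>) * (T w - t)\<^sup>2 + (1 + 1 / \<eta>) * (t - s)\<^sup>2 \<partial>P)"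
  proof (rule integral_mono)
    show "integrable P (\<lambda>w. (T w - s)\<^sup>2)"
      by (rule shifted_square_moments(2)[OF P T T2])
    fix w
    show "(T w - s)\<^sup>2 \<le> (1 + \<eta>) * (T w - t)\<^sup>2 + (1 + 1 / \<eta>) * (t - s)\<^sup>2"
      using power2_sum_le_weighted[OF \<eta>, of "T w - t" "t - s"] by simp
  qed (use i2 in auto)
  also have "\<dots> = (1 + \<eta>) * (\<integral>w. (T w - t)\<^sup>2 \<partial>P) + (1 + 1 / \<eta>) * (t - s)\<^sup>2"
    using i2 by (simp add: prob_space)
  also have "\<dots> \<le> (1 + \<eta>) * x + (1 + 1 / \<eta>) * \<eta>\<^sup>2"
    using \<eta> s \<open>(\<integral>w. (T w - t)\<^sup>2 \<partial>P) \<le> x\<close>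
    by (intro add_mono mult_left_mono) (auto simp: abs_le_square_iff[symmetric])
  also have "(1 + 1 / \<eta>) * \<eta>\<^sup>2 = \<eta>\<^sup>2 + \<eta>"
    using \<eta> by (simp add: power2_eq_square field_simps)
  finally show "(\<integral>w. (T w - s)\<^sup>2 \<partial>P) \<le> (1 + \<eta>) * x + \<eta>\<^sup>2 + \<eta>" by simp
qed

section \<open>Differentiability in quadratic mean\<close>

lemma sets_sum_measure [simp]: "sets (sum_measure P Q) = sets P"
  by (simp add: sum_measure_def)

lemma emeasure_sum_measure:
  assumes "sets Q = sets P" and A: "A \<in> sets P"
  shows "emeasure (sum_measure P Q) A = emeasure P A + emeasure Q A"
  unfolding sum_measure_def
proof (rule emeasure_measure_of_sigma)
  show "sigma_algebra (space P) (sets P)" ..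
  show "positive (sets P) (\<lambda>A. emeasure P A + emeasure Q A)"
    by (simp add: positive_def)
  show "countably_additive (sets P) (\<lambda>A. emeasure P A + emeasure Q A)"
    unfolding countably_additive_def
  proof (intro allI impI)
    fix A :: "nat \<Rightarrow> 'a set"
    assume A: "range A \<subseteq> sets P" "disjoint_family A"
    then show "(\<Sum>i. emeasure P (A i) + emeasure Q (A i)) = emeasure P (\<Union>(range A)) + emeasure Q (\<Union>(range A))"
      using assms(1) by (simp add: suminf_add[symmetric] suminf_emeasure)
  qed
qed (rule A)

text \<open>A Radon-Nikodym derivative may be infinite, and \<open>enn2real\<close> sends that value
  to 0; the total mass 1 of \<open>P\<close> confines this to a null set.\<close>

lemma nn_integral_real_density:
  assumes fin: "finite_measure \<mu>" and sets: "sets \<mu> = sets M" and P: "P \<in> space (prob_algebra M)"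
    and ac: "absolutely_continuous \<mu> P" and f[measurable]: "f \<in> borel_measurable M"
  shows "(\<integral>\<^sup>+x. f x \<partial>P) = (\<integral>\<^sup>+x. ennreal (real_density \<mu> P x) * f x \<partial>\<mu>)"
proof -
  interpret \<mu>: finite_measure \<mu> by (rule fin)
  interpret P: prob_space P using P by (simp add: space_prob_algebra)
  have setP: "sets P = sets \<mu>" using P sets by (simp add: space_prob_algebra)
  note sets[measurable_cong]
  have "(\<integral>\<^sup>+x. RN_deriv \<mu> P x * 1 \<partial>\<mu>) = (\<integral>\<^sup>+x. 1 \<partial>P)"
    using ac setP by (intro \<mu>.RN_deriv_nn_integral[symmetric]) auto
  then have "(\<integral>\<^sup>+x. RN_deriv \<mu> P x \<partial>\<mu>) \<noteq> \<infinity>"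
    by (simp add: P.emeasure_space_1)
  then have fin: "AE x in \<mu>. RN_deriv \<mu> P x \<noteq> \<infinity>"
    by (intro nn_integral_PInf_AE) auto
  have "(\<integral>\<^sup>+x. f x \<partial>P) = (\<integral>\<^sup>+x. RN_deriv \<mu> P x * f x \<partial>\<mu>)"
    using ac setP by (intro \<mu>.RN_deriv_nn_integral) auto
  also have "\<dots> = (\<integral>\<^sup>+x. ennreal (real_density \<mu> P x) * f x \<partial>\<mu>)"
    using fin by (intro nn_integral_cong_AE) (auto simp: real_density_def less_top elim!: AE_mp)
  finally show ?thesis .
qed

text \<open>The root \<open>l\<close> of the likelihood ratio carries only the part of \<open>E \<theta>\<close> that is absolutely
  continuous with respect to \<open>E \<theta>\<^sub>0\<close>; the mass of the singular part is at most the remainder.\<close>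

lemma dqm_root_likelihood:
  assumes E0: "E \<theta>\<^sub>0 \<in> space (prob_algebra M)" and E: "E \<theta> \<in> space (prob_algebra M)"
    and s[measurable]: "s \<in> borel_measurable M" and r: "dqm_remainder E \<theta>\<^sub>0 s \<theta> \<le> ennreal r"
  obtains l :: "'y \<Rightarrow> real" where "l \<in> borel_measurable M" and "\<And>y. 0 \<le> l y"
    and "\<And>f. f \<in> borel_measurable M \<Longrightarrow> (\<integral>\<^sup>+y. f y * ennreal ((l y)\<^sup>2) \<partial>E \<theta>\<^sub>0) \<le> (\<integral>\<^sup>+y. f y \<partial>E \<theta>)"
    and "(\<integral>\<^sup>+y. ennreal ((l y - 1 - (\<theta> - \<theta>\<^sub>0) / 2 * s y)\<^sup>2) \<partial>E \<theta>\<^sub>0) \<le> ennreal r"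
    and "1 \<le> (\<integral>\<^sup>+y. ennreal ((l y)\<^sup>2) \<partial>E \<theta>\<^sub>0) + ennreal r"
proof -
  define \<mu> where "\<mu> = sum_measure (E \<theta>\<^sub>0) (E \<theta>)"
  define p0 where "p0 = real_density \<mu> (E \<theta>\<^sub>0)"
  define p where "p = real_density \<mu> (E \<theta>)"
  \<comment> \<open>Division by zero yields 0, so \<open>l\<close> vanishes where \<open>p0\<close>
    does and the singular part of \<open>E \<theta>\<close> is dropped.\<close>
  define l where "l = (\<lambda>y. sqrt (p y / p0 y))"
  interpret E0: prob_space "E \<theta>\<^sub>0" using E0 by (simp add: space_prob_algebra)
  interpret E: prob_space "E \<theta>" using E by (simp add: space_prob_algebra)
  have sets: "sets (E \<theta>\<^sub>0) = sets M" "sets (E \<theta>) = sets M"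
    using E0 E by (auto simp: space_prob_algebra)
  then have sets\<mu>[measurable_cong]: "sets \<mu> = sets M"
    by (simp add: \<mu>_def)
  have em: "emeasure \<mu> A = emeasure (E \<theta>\<^sub>0) A + emeasure (E \<theta>) A" if "A \<in> sets M" for A
    using that sets unfolding \<mu>_def by (intro emeasure_sum_measure) auto
  have fin: "finite_measure \<mu>"
    using em[of "space \<mu>"] sets.top[of \<mu>] sets\<mu> by (intro finite_measureI) auto
  have ac: "absolutely_continuous \<mu> (E \<theta>\<^sub>0)" "absolutely_continuous \<mu> (E \<theta>)"
    using em sets sets\<mu> by (auto simp: absolutely_continuous_def null_sets_def)
  note int0 = nn_integral_real_density[OF fin sets\<mu> E0 ac(1), folded p0_def]
    and int = nn_integral_real_density[OF fin sets\<mu> E ac(2), folded p_def]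
  have p_meas[measurable]: "p \<in> borel_measurable M" "p0 \<in> borel_measurable M"
    unfolding p_def p0_def real_density_def by measurable
  have p_nonneg: "0 \<le> p y" "0 \<le> p0 y" for y
    unfolding p_def p0_def real_density_def by auto
  have l_meas[measurable]: "l \<in> borel_measurable M"
    unfolding l_def by measurable
  have l2: "(l y)\<^sup>2 = p y / p0 y" for y
    using p_nonneg by (simp add: l_def)
  let ?rem = "\<lambda>y. (sqrt (p y) - sqrt (p0 y) - (\<theta> - \<theta>\<^sub>0) / 2 * s y * sqrt (p0 y))\<^sup>2"
  have rem: "(\<integral>\<^sup>+y. ennreal (?rem y) \<partial>\<mu>) \<le> ennreal r"
    using r by (simp add: dqm_remainder_def Let_def \<mu>_def p_def p0_def)
  show ?thesis
  proof (rule that[of l])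
    fix f :: "'y \<Rightarrow> ennreal" assume f[measurable]: "f \<in> borel_measurable M"
    have "(\<integral>\<^sup>+y. f y * ennreal ((l y)\<^sup>2) \<partial>E \<theta>\<^sub>0) = (\<integral>\<^sup>+y. ennreal (p0 y) * (f y * ennreal ((l y)\<^sup>2)) \<partial>\<mu>)"
      by (rule int0) measurable
    also have "\<dots> \<le> (\<integral>\<^sup>+y. ennreal (p y) * f y \<partial>\<mu>)"
    proof (rule nn_integral_mono)
      fix y
      have "ennreal (p0 y) * (f y * ennreal ((l y)\<^sup>2)) = ennreal (p0 y * (l y)\<^sup>2) * f y"
        using p_nonneg by (simp add: ennreal_mult ac_simps)
      also have "p0 y * (l y)\<^sup>2 \<le> p y"
        using p_nonneg[of y] by (cases "p0 y = 0") (auto simp: l2)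
      finally show "ennreal (p0 y) * (f y * ennreal ((l y)\<^sup>2)) \<le> ennreal (p y) * f y"
        by (simp add: mult_right_mono ennreal_leI)
    qed
    also have "\<dots> = (\<integral>\<^sup>+y. f y \<partial>E \<theta>)"
      by (rule int[symmetric]) measurable
    finally show "(\<integral>\<^sup>+y. f y * ennreal ((l y)\<^sup>2) \<partial>E \<theta>\<^sub>0) \<le> (\<integral>\<^sup>+y. f y \<partial>E \<theta>)" .
  next
    have "(\<integral>\<^sup>+y. ennreal ((l y - 1 - (\<theta> - \<theta>\<^sub>0) / 2 * s y)\<^sup>2) \<partial>E \<theta>\<^sub>0)
        = (\<integral>\<^sup>+y. ennreal (p0 y) * ennreal ((l y - 1 - (\<theta> - \<theta>\<^sub>0) / 2 * s y)\<^sup>2) \<partial>\<mu>)"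
      by (rule int0) measurable
    also have "\<dots> \<le> (\<integral>\<^sup>+y. ennreal (?rem y) \<partial>\<mu>)"
    proof (rule nn_integral_mono)
      fix y
      have "p0 y * (l y - 1 - (\<theta> - \<theta>\<^sub>0) / 2 * s y)\<^sup>2 = (sqrt (p0 y) * (l y - 1 - (\<theta> - \<theta>\<^sub>0) / 2 * s y))\<^sup>2"
        using p_nonneg by (simp add: power_mult_distrib)
      also have "\<dots> \<le> ?rem y"
      proof (cases "p0 y = 0")
        case False
        then have "sqrt (p0 y) * l y = sqrt (p y)"
          by (simp add: l_def real_sqrt_divide)
        then have "sqrt (p0 y) * (l y - 1 - (\<theta> - \<theta>\<^sub>0) / 2 * s y) = sqrt (p y) - sqrt (p0 y) - (\<theta> - \<theta>\<^sub>0) / 2 * s y * sqrt (p0 y)"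
          by (simp add: right_diff_distrib ac_simps)
        then show ?thesis by simp
      qed simp
      finally show "ennreal (p0 y) * ennreal ((l y - 1 - (\<theta> - \<theta>\<^sub>0) / 2 * s y)\<^sup>2) \<le> ennreal (?rem y)"
        using p_nonneg by (simp add: ennreal_leI flip: ennreal_mult)
    qed
    also note rem
    finally show "(\<integral>\<^sup>+y. ennreal ((l y - 1 - (\<theta> - \<theta>\<^sub>0) / 2 * s y)\<^sup>2) \<partial>E \<theta>\<^sub>0) \<le> ennreal r" .
  next
    have "1 = (\<integral>\<^sup>+y. 1 \<partial>E \<theta>)"
      by (simp add: E.emeasure_space_1)
    also have "\<dots> = (\<integral>\<^sup>+y. ennreal (p y) * 1 \<partial>\<mu>)"
      by (rule int) measurable
    also have "\<dots> \<le> (\<integral>\<^sup>+y. ennreal (p0 y) * ennreal ((l y)\<^sup>2) + ennreal (?rem y) \<partial>\<mu>)"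
    proof (rule nn_integral_mono)
      fix y
      \<comment> \<open>Where \<open>p0 y = 0\<close> the remainder integrand is \<open>p y\<close>
        itself; this is how it absorbs the singular mass.\<close>
      have "p y \<le> p0 y * (l y)\<^sup>2 + ?rem y"
        using p_nonneg[of y] by (cases "p0 y = 0") (auto simp: l2)
      then have "ennreal (p y) \<le> ennreal (p0 y * (l y)\<^sup>2 + ?rem y)"
        by (rule ennreal_leI)
      then show "ennreal (p y) * 1 \<le> ennreal (p0 y) * ennreal ((l y)\<^sup>2) + ennreal (?rem y)"
        using p_nonneg by (simp flip: ennreal_mult ennreal_plus)
    qed
    also have "\<dots> = (\<integral>\<^sup>+y. ennreal (p0 y) * ennreal ((l y)\<^sup>2) \<partial>\<mu>) + (\<integral>\<^sup>+y. ennreal (?rem y) \<partial>\<mu>)"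
      by (rule nn_integral_add) measurable
    also have "(\<integral>\<^sup>+y. ennreal (p0 y) * ennreal ((l y)\<^sup>2) \<partial>\<mu>) = (\<integral>\<^sup>+y. ennreal ((l y)\<^sup>2) \<partial>E \<theta>\<^sub>0)"
      by (rule int0[symmetric]) measurable
    also have "\<dots> + (\<integral>\<^sup>+y. ennreal (?rem y) \<partial>\<mu>) \<le> \<dots> + ennreal r"
      by (intro add_left_mono rem)
    finally show "1 \<le> (\<integral>\<^sup>+y. ennreal ((l y)\<^sup>2) \<partial>E \<theta>\<^sub>0) + ennreal r" .
  qed (use p_nonneg in \<open>auto simp: l_def\<close>)
qed

text \<open>Polarisation of the likelihood roots,
  \<open>2 * (l * l') = l\<^sup>2 + l'\<^sup>2 - (l - l')\<^sup>2\<close>: the masses are at least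
  \<open>1 - r\<close> and \<open>1 - r'\<close>, and the main part of the difference is
  \<open>(\<theta> - \<theta>') / 2 * s\<close>, of squared norm
  \<open>(\<theta> - \<theta>')\<^sup>2 * J / 4\<close>. Halving gives the 8; in
  \<open>3 / 2\<close> one half comes from the lost masses and 1 from the remainders.\<close>

lemma dqm_affinity_ge:
  assumes E0: "E \<theta>\<^sub>0 \<in> space (prob_algebra M)"
    and E: "E \<theta> \<in> space (prob_algebra M)" and E': "E \<theta>' \<in> space (prob_algebra M)"
    and s[measurable]: "s \<in> borel_measurable M" and s2: "integrable (E \<theta>\<^sub>0) (\<lambda>y. (s y)\<^sup>2)"
    and J: "J = (\<integral>y. (s y)\<^sup>2 \<partial>E \<theta>\<^sub>0)"
    and r: "dqm_remainder E \<theta>\<^sub>0 s \<theta> \<le> ennreal r" "0 \<le> r"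
    and r': "dqm_remainder E \<theta>\<^sub>0 s \<theta>' \<le> ennreal r'" "0 \<le> r'"
    and \<eta>: "0 < \<eta>" and \<rho>: "0 \<le> \<rho>"
    and le: "\<rho> \<le> 1 - ((1 + \<eta>) * (\<theta> - \<theta>')\<^sup>2 * J / 8 + (3 / 2 + 1 / \<eta>) * (r + r'))"
  shows "affinity_ge M (E \<theta>) (E \<theta>') \<rho>"
proof (rule affinity_geI[OF E E' \<rho>])
  fix f g :: "'a \<Rightarrow> ennreal"
  assume f[measurable]: "f \<in> borel_measurable M" and g[measurable]: "g \<in> borel_measurable M"
    and fg: "\<And>x. x \<in> space M \<Longrightarrow> 1 \<le> f x * g x"
  interpret E0: prob_space "E \<theta>\<^sub>0" using E0 by (simp add: space_prob_algebra)
  have sets[measurable_cong]: "sets (E \<theta>\<^sub>0) = sets M"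
    using E0 by (auto simp: space_prob_algebra)
  obtain l where l[measurable]: "l \<in> borel_measurable M" and l0: "\<And>y. 0 \<le> l y"
    and lf: "\<And>f. f \<in> borel_measurable M \<Longrightarrow> (\<integral>\<^sup>+y. f y * ennreal ((l y)\<^sup>2) \<partial>E \<theta>\<^sub>0) \<le> (\<integral>\<^sup>+y. f y \<partial>E \<theta>)"
    and lr: "(\<integral>\<^sup>+y. ennreal ((l y - 1 - (\<theta> - \<theta>\<^sub>0) / 2 * s y)\<^sup>2) \<partial>E \<theta>\<^sub>0) \<le> ennreal r"
    and l1: "1 \<le> (\<integral>\<^sup>+y. ennreal ((l y)\<^sup>2) \<partial>E \<theta>\<^sub>0) + ennreal r"
    by (rule dqm_root_likelihood[of E, OF E0 E s r(1)], rule that, assumption+)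
  obtain l' where l'[measurable]: "l' \<in> borel_measurable M" and l0': "\<And>y. 0 \<le> l' y"
    and lf': "\<And>f. f \<in> borel_measurable M \<Longrightarrow> (\<integral>\<^sup>+y. f y * ennreal ((l' y)\<^sup>2) \<partial>E \<theta>\<^sub>0) \<le> (\<integral>\<^sup>+y. f y \<partial>E \<theta>')"
    and lr': "(\<integral>\<^sup>+y. ennreal ((l' y - 1 - (\<theta>' - \<theta>\<^sub>0) / 2 * s y)\<^sup>2) \<partial>E \<theta>\<^sub>0) \<le> ennreal r'"
    and l1': "1 \<le> (\<integral>\<^sup>+y. ennreal ((l' y)\<^sup>2) \<partial>E \<theta>\<^sub>0) + ennreal r'"
    by (rule dqm_root_likelihood[of E, OF E0 E' s r'(1)], rule that, assumption+)
  have bounded: "integrable (E \<theta>\<^sub>0) u \<and> (\<integral>y. u y \<partial>E \<theta>\<^sub>0) \<le> c"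
    if [measurable]: "u \<in> borel_measurable M" and "\<And>y. 0 \<le> u y" "(\<integral>\<^sup>+y. ennreal (u y) \<partial>E \<theta>\<^sub>0) \<le> ennreal c" "0 \<le> c"
    for u c
  proof -
    have "integrable (E \<theta>\<^sub>0) u"
      using that le_less_trans[OF that(3) ennreal_less_top] by (intro integrableI_nonneg) auto
    then show ?thesis
      using that by (auto simp: nn_integral_eq_integral)
  qed
  let ?R = "\<lambda>y. l y - 1 - (\<theta> - \<theta>\<^sub>0) / 2 * s y" and ?R' = "\<lambda>y. l' y - 1 - (\<theta>' - \<theta>\<^sub>0) / 2 * s y"
  have R: "integrable (E \<theta>\<^sub>0) (\<lambda>y. (?R y)\<^sup>2)" "(\<integral>y. (?R y)\<^sup>2 \<partial>E \<theta>\<^sub>0) \<le> r"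
    using bounded[OF _ _ lr r(2)] by auto
  have R': "integrable (E \<theta>\<^sub>0) (\<lambda>y. (?R' y)\<^sup>2)" "(\<integral>y. (?R' y)\<^sup>2 \<partial>E \<theta>\<^sub>0) \<le> r'"
    using bounded[OF _ _ lr' r'(2)] by auto
  have "emeasure (E \<theta>) (space (E \<theta>)) = 1" "emeasure (E \<theta>') (space (E \<theta>')) = 1"
    using E E' by (auto simp: space_prob_algebra prob_space.emeasure_space_1)
  then have L: "integrable (E \<theta>\<^sub>0) (\<lambda>y. (l y)\<^sup>2)" and L': "integrable (E \<theta>\<^sub>0) (\<lambda>y. (l' y)\<^sup>2)"
    using bounded[of "\<lambda>y. (l y)\<^sup>2" 1] bounded[of "\<lambda>y. (l' y)\<^sup>2" 1] lf[of "\<lambda>_. 1"] lf'[of "\<lambda>_. 1"] by auto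
  have mass: "1 - r \<le> (\<integral>y. (l y)\<^sup>2 \<partial>E \<theta>\<^sub>0)" "1 - r' \<le> (\<integral>y. (l' y)\<^sup>2 \<partial>E \<theta>\<^sub>0)"
    using l1 l1' r r' L L' by (auto simp: nn_integral_eq_integral simp flip: ennreal_plus)
  define B where "B = (\<lambda>y. (1 + \<eta>) * ((\<theta> - \<theta>')\<^sup>2 / 4 * (s y)\<^sup>2) + (1 + 1 / \<eta>) * (2 * (?R y)\<^sup>2 + 2 * (?R' y)\<^sup>2))"
  have B: "(l y - l' y)\<^sup>2 \<le> B y" for y
  proof -
    have "l y - l' y = (\<theta> - \<theta>') / 2 * s y + (?R y - ?R' y)"
      by (simp add: field_simps)
    then have "(l y - l' y)\<^sup>2 \<le> (1 + \<eta>) * ((\<theta> - \<theta>') / 2 * s y)\<^sup>2 + (1 + 1 / \<eta>) * (?R y - ?R' y)\<^sup>2"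
      using power2_sum_le_weighted[OF \<eta>] by metis
    also have "\<dots> \<le> (1 + \<eta>) * ((\<theta> - \<theta>') / 2 * s y)\<^sup>2 + (1 + 1 / \<eta>) * (2 * (?R y)\<^sup>2 + 2 * (?R' y)\<^sup>2)"
    proof (intro add_left_mono mult_left_mono)
      show "(?R y - ?R' y)\<^sup>2 \<le> 2 * (?R y)\<^sup>2 + 2 * (?R' y)\<^sup>2"
        using zero_le_power2[of "?R y + ?R' y"] unfolding power2_sum power2_diff[of "?R y" "?R' y"] by linarith
    qed (use \<eta> in simp)
    finally show ?thesis
      by (simp add: B_def power_mult_distrib power_divide)
  qed
  have iB: "integrable (E \<theta>\<^sub>0) B"
    unfolding B_def using s2 R R' by (intro Bochner_Integration.integrable_add integrable_mult_right) auto
  have "(\<integral>y. B y \<partial>E \<theta>\<^sub>0) = (1 + \<eta>) * ((\<theta> - \<theta>')\<^sup>2 / 4 * J) + (1 + 1 / \<eta>) * (2 * (\<integral>y. (?R y)\<^sup>2 \<partial>E \<theta>\<^sub>0) + 2 * (\<integral>y. (?R' y)\<^sup>2 \<partial>E \<theta>\<^sub>0))"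
    unfolding B_def J using s2 R R' by simp
  also have "\<dots> \<le> (1 + \<eta>) * ((\<theta> - \<theta>')\<^sup>2 / 4 * J) + (1 + 1 / \<eta>) * (2 * r + 2 * r')"
    using R(2) R'(2) \<eta> by (intro add_left_mono mult_left_mono add_mono) auto
  finally have intB: "(\<integral>y. B y \<partial>E \<theta>\<^sub>0) \<le> (1 + \<eta>) * ((\<theta> - \<theta>')\<^sup>2 / 4 * J) + (1 + 1 / \<eta>) * (2 * r + 2 * r')" .
  have prod: "2 * (l y * l' y) = (l y)\<^sup>2 + (l' y)\<^sup>2 - (l y - l' y)\<^sup>2" for y
    by (simp add: power2_diff)
  have "2 * \<rho> \<le> (1 - r) + (1 - r') - ((1 + \<eta>) * ((\<theta> - \<theta>')\<^sup>2 / 4 * J) + (1 + 1 / \<eta>) * (2 * r + 2 * r'))"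
    using le by (simp add: algebra_simps add_divide_distrib)
  also have "\<dots> \<le> (\<integral>y. (l y)\<^sup>2 \<partial>E \<theta>\<^sub>0) + (\<integral>y. (l' y)\<^sup>2 \<partial>E \<theta>\<^sub>0) - (\<integral>y. B y \<partial>E \<theta>\<^sub>0)"
    using mass intB by simp
  also have "\<dots> = (\<integral>y. (l y)\<^sup>2 + (l' y)\<^sup>2 - B y \<partial>E \<theta>\<^sub>0)"
    using L L' iB by simp
  \<comment> \<open>The positive part permits the passage to a nonnegative integral, and it stays
    below \<open>2 * (l y * l' y)\<close> because the roots are nonnegative.\<close>
  also have "\<dots> \<le> (\<integral>y. max 0 ((l y)\<^sup>2 + (l' y)\<^sup>2 - B y) \<partial>E \<theta>\<^sub>0)"
    using L L' iB by (intro integral_mono) auto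
  finally have "ennreal (2 * \<rho>) \<le> ennreal (\<integral>y. max 0 ((l y)\<^sup>2 + (l' y)\<^sup>2 - B y) \<partial>E \<theta>\<^sub>0)"
    by (rule ennreal_leI)
  also have "\<dots> = (\<integral>\<^sup>+y. ennreal (max 0 ((l y)\<^sup>2 + (l' y)\<^sup>2 - B y)) \<partial>E \<theta>\<^sub>0)"
    using L L' iB by (intro nn_integral_eq_integral[symmetric]) auto
  also have "\<dots> \<le> (\<integral>\<^sup>+y. f y * ennreal ((l y)\<^sup>2) + g y * ennreal ((l' y)\<^sup>2) \<partial>E \<theta>\<^sub>0)"
  proof (rule nn_integral_mono)
    fix y assume "y \<in> space (E \<theta>\<^sub>0)"
    then have "1 \<le> f y * g y" using fg sets_eq_imp_space_eq[OF sets] by auto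
    have "ennreal (max 0 ((l y)\<^sup>2 + (l' y)\<^sup>2 - B y)) \<le> ennreal (2 * (l y * l' y))"
      using B[of y] prod[of y] mult_nonneg_nonneg[OF l0[of y] l0'[of y]]
      by (intro ennreal_leI max.boundedI) linarith+
    also have "\<dots> \<le> f y * ennreal ((l y)\<^sup>2) + g y * ennreal ((l' y)\<^sup>2)"
      by (intro weighted_am_gm_ennreal l0 l0') fact
    finally show "ennreal (max 0 ((l y)\<^sup>2 + (l' y)\<^sup>2 - B y)) \<le> f y * ennreal ((l y)\<^sup>2) + g y * ennreal ((l' y)\<^sup>2)" .
  qed
  also have "\<dots> = (\<integral>\<^sup>+y. f y * ennreal ((l y)\<^sup>2) \<partial>E \<theta>\<^sub>0) + (\<integral>\<^sup>+y. g y * ennreal ((l' y)\<^sup>2) \<partial>E \<theta>\<^sub>0)"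
    by (rule nn_integral_add) measurable
  also have "\<dots> \<le> (\<integral>\<^sup>+y. f y \<partial>E \<theta>) + (\<integral>\<^sup>+y. g y \<partial>E \<theta>')"
    by (intro add_mono lf lf' f g)
  finally show "ennreal (2 * \<rho>) \<le> (\<integral>\<^sup>+y. f y \<partial>E \<theta>) + (\<integral>\<^sup>+y. g y \<partial>E \<theta>')" .
qed

section \<open>Rescaling to local parameters at distance of order 1 / sqrt n\<close>

lemma local_parameter_tendsto:
  "(\<lambda>n. \<theta>\<^sub>0 + h / sqrt (real n)) \<longlonglongrightarrow> \<theta>\<^sub>0"
proof -
  have "filterlim (\<lambda>n. sqrt (real n)) at_top sequentially"
    by (rule filterlim_compose[OF sqrt_at_top filterlim_real_sequentially])
  then have "(\<lambda>n. h / sqrt (real n)) \<longlonglongrightarrow> 0"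
    by (rule real_tendsto_divide_at_top[OF tendsto_const])
  then show ?thesis
    using tendsto_add[OF tendsto_const[of \<theta>\<^sub>0]] by fastforce
qed

lemma eventually_local_parameter_in:
  assumes "\<theta>\<^sub>0 \<in> interior \<Theta>"
  shows "\<forall>\<^sub>F n in sequentially. \<theta>\<^sub>0 + h / sqrt (real n) \<in> \<Theta>"
  using topological_tendstoD[OF local_parameter_tendsto open_interior assms, of h]
  by (rule eventually_mono) (use interior_subset in auto)

text \<open>\<open>h \<noteq> 0\<close> keeps the sequence off \<open>\<theta>\<^sub>0\<close>, as
  the limit in \<open>dqm_at\<close> is a punctured one.\<close>

lemma dqm_eventually_remainder_le:
  assumes \<theta>\<^sub>0: "\<theta>\<^sub>0 \<in> interior \<Theta>" and h: "h \<noteq> 0" and \<epsilon>: "0 < \<epsilon>"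
    and lim: "((\<lambda>\<theta>. dqm_remainder E \<theta>\<^sub>0 s \<theta> / ennreal ((\<theta> - \<theta>\<^sub>0)\<^sup>2)) \<longlongrightarrow> 0) (at \<theta>\<^sub>0 within \<Theta>)"
  shows "\<forall>\<^sub>F n in sequentially. dqm_remainder E \<theta>\<^sub>0 s (\<theta>\<^sub>0 + h / sqrt (real n)) \<le> ennreal (\<epsilon> * h\<^sup>2 / n)"
proof -
  have "\<forall>\<^sub>F n in sequentially. \<theta>\<^sub>0 + h / sqrt (real n) \<in> \<Theta> \<and> \<theta>\<^sub>0 + h / sqrt (real n) \<noteq> \<theta>\<^sub>0"
    using eventually_local_parameter_in[OF \<theta>\<^sub>0, of h] eventually_gt_at_top[of 0]
    by eventually_elim (use h in auto)
  then have "filterlim (\<lambda>n. \<theta>\<^sub>0 + h / sqrt (real n)) (at \<theta>\<^sub>0 within \<Theta>) sequentially"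
    using local_parameter_tendsto by (simp add: filterlim_at)
  from filterlim_compose[OF lim this]
  have "\<forall>\<^sub>F n in sequentially. dqm_remainder E \<theta>\<^sub>0 s (\<theta>\<^sub>0 + h / sqrt (real n)) / ennreal ((h / sqrt (real n))\<^sup>2) < ennreal \<epsilon>"
    using \<epsilon> by (intro order_tendstoD(2)) auto
  then show ?thesis
    using eventually_gt_at_top[of 0]
  proof eventually_elim
    case (elim n)
    let ?c = "(h / sqrt (real n))\<^sup>2"
    have c: "?c = h\<^sup>2 / n" "?c > 0"
      using h elim(2) by (auto simp: power_divide)
    have "dqm_remainder E \<theta>\<^sub>0 s (\<theta>\<^sub>0 + h / sqrt (real n)) = dqm_remainder E \<theta>\<^sub>0 s (\<theta>\<^sub>0 + h / sqrt (real n)) / ennreal ?c * ennreal ?c"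
      using c(2) by (subst ennreal_divide_times) (simp add: ennreal_divide_self)
    also have "\<dots> \<le> ennreal \<epsilon> * ennreal ?c"
      using elim(1) by (intro mult_right_mono) auto
    also have "\<dots> = ennreal (\<epsilon> * h\<^sup>2 / n)"
      using \<epsilon> c by (simp flip: ennreal_mult)
    finally show ?case .
  qed
qed

lemma dqm_information_nonneg:
  "dqm_at \<Theta> M E \<theta>\<^sub>0 J \<Longrightarrow> 0 \<le> J"
  by (auto simp: dqm_at_def)

lemma dqm_eventually_affinity_ge:
  assumes \<theta>\<^sub>0: "\<theta>\<^sub>0 \<in> interior \<Theta>" and E: "statistical_experiment \<Theta> M E" and dqm: "dqm_at \<Theta> M E \<theta>\<^sub>0 J"
    and h: "h \<noteq> 0" "h' \<noteq> 0" and \<kappa>: "0 < \<kappa>"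
  shows "\<forall>\<^sub>F n in sequentially. affinity_ge M (E (\<theta>\<^sub>0 + h / sqrt (real n))) (E (\<theta>\<^sub>0 + h' / sqrt (real n)))
     (1 - (J * (h - h')\<^sup>2 / 8 + \<kappa>) / n)"
proof -
  obtain s where s: "s \<in> borel_measurable M" "integrable (E \<theta>\<^sub>0) (\<lambda>y. (s y)\<^sup>2)"
    and J: "J = (\<integral>y. (s y)\<^sup>2 \<partial>E \<theta>\<^sub>0)"
    and lim: "((\<lambda>\<theta>. dqm_remainder E \<theta>\<^sub>0 s \<theta> / ennreal ((\<theta> - \<theta>\<^sub>0)\<^sup>2)) \<longlongrightarrow> 0) (at \<theta>\<^sub>0 within \<Theta>)"
    using dqm unfolding dqm_at_def by auto
  define A where "A = J * (h - h')\<^sup>2 / 8"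
  have A: "0 \<le> A" using dqm_information_nonneg[OF dqm] by (simp add: A_def)
  \<comment> \<open>\<eta> and \<epsilon> each consume half of the allowance \<kappa>: the first
    inflates the main term \<open>A\<close>, the second pays for the two remainders. The
    \<open>+ 1\<close> covers \<open>A = 0\<close>.\<close>
  define \<eta> where "\<eta> = \<kappa> / (2 * (A + 1))"
  have \<eta>: "0 < \<eta>" using \<kappa> A by (simp add: \<eta>_def)
  define c where "c = (3 / 2 + 1 / \<eta>) * (h\<^sup>2 + h'\<^sup>2)"
  have c: "0 < c" using \<eta> h by (simp add: c_def add_pos_pos)
  define \<epsilon> where "\<epsilon> = \<kappa> / (2 * c)"
  have \<epsilon>: "0 < \<epsilon>" using \<kappa> c by (simp add: \<epsilon>_def)
  have "\<eta> * A \<le> \<kappa> / 2"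
    using \<kappa> A by (simp add: \<eta>_def field_simps)
  moreover have "\<epsilon> * c = \<kappa> / 2"
    using c by (simp add: \<epsilon>_def)
  ultimately have total: "(1 + \<eta>) * A + \<epsilon> * c \<le> A + \<kappa>"
    by (simp add: algebra_simps)
  have "\<theta>\<^sub>0 \<in> \<Theta>" using \<theta>\<^sub>0 interior_subset by auto
  \<comment> \<open>Makes the claimed affinity nonnegative, as the one-observation bound
    requires.\<close>
  have "\<forall>\<^sub>F n in sequentially. A + \<kappa> \<le> real n"
    using filterlim_real_sequentially by (simp add: filterlim_at_top)
  then show ?thesis
    using dqm_eventually_remainder_le[OF \<theta>\<^sub>0 h(1) \<epsilon> lim] dqm_eventually_remainder_le[OF \<theta>\<^sub>0 h(2) \<epsilon> lim]
      eventually_local_parameter_in[OF \<theta>\<^sub>0, of h] eventually_local_parameter_in[OF \<theta>\<^sub>0, of h']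
      eventually_gt_at_top[of 0]
  proof eventually_elim
    case (elim n)
    have diff: "(\<theta>\<^sub>0 + h / sqrt (real n) - (\<theta>\<^sub>0 + h' / sqrt (real n)))\<^sup>2 = (h - h')\<^sup>2 / n"
      by (simp add: power_divide flip: diff_divide_distrib)
    have "(1 + \<eta>) * ((h - h')\<^sup>2 / n) * J / 8 + (3 / 2 + 1 / \<eta>) * (\<epsilon> * h\<^sup>2 / n + \<epsilon> * h'\<^sup>2 / n)
        = ((1 + \<eta>) * A + \<epsilon> * c) / n"
      by (simp add: A_def c_def add_divide_distrib distrib_left ac_simps)
    also have "\<dots> \<le> (A + \<kappa>) / n"
      using total by (rule divide_right_mono) simp
    finally have le: "1 - (A + \<kappa>) / n \<le>
       1 - ((1 + \<eta>) * ((h - h')\<^sup>2 / n) * J / 8 + (3 / 2 + 1 / \<eta>) * (\<epsilon> * h\<^sup>2 / n + \<epsilon> * h'\<^sup>2 / n))"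
      by simp
    have "0 \<le> 1 - (A + \<kappa>) / n"
      using elim by (simp add: field_simps)
    moreover have "E \<theta>\<^sub>0 \<in> space (prob_algebra M)" "E (\<theta>\<^sub>0 + h / sqrt (real n)) \<in> space (prob_algebra M)"
       "E (\<theta>\<^sub>0 + h' / sqrt (real n)) \<in> space (prob_algebra M)"
      using E elim \<open>\<theta>\<^sub>0 \<in> \<Theta>\<close> by (auto simp: statistical_experiment_def)
    ultimately show ?case
      using elim s J \<epsilon> \<eta> le unfolding A_def[symmetric] diff[symmetric]
      by (intro dqm_affinity_ge[where \<eta>=\<eta> and r="\<epsilon> * h\<^sup>2 / n" and r'="\<epsilon> * h'\<^sup>2 / n"]) auto
  qed
qed

section \<open>Lower bound\<close>

text \<open>Differentiability at one point gives uniformity in \<open>h\<close>: the error is a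
  small multiple of the distance \<open>\<bar>h\<bar> / sqrt n\<close>, and multiplication by
  \<open>sqrt n\<close> turns this into a small multiple of
  \<open>\<bar>h\<bar> \<le> H\<close>.\<close>

lemma eventually_local_target_near:
  assumes deriv: "(\<psi> has_real_derivative b) (at \<theta>\<^sub>0)" and \<epsilon>: "0 < \<epsilon>" and H: "0 \<le> H"
  shows "\<forall>\<^sub>F n in sequentially. \<forall>h. \<bar>h\<bar> \<le> H \<longrightarrow> \<bar>local_target \<psi> \<theta>\<^sub>0 n h - b * h\<bar> \<le> \<epsilon>"
proof -
  define e where "e = \<epsilon> / (H + 1)"
  have e: "0 < e" "e * H \<le> \<epsilon>"
    using \<epsilon> H by (auto simp: e_def field_simps)
  obtain d where d: "0 < d" and near: "\<And>y. \<bar>y - \<theta>\<^sub>0\<bar> < d \<Longrightarrow> \<bar>\<psi> y - \<psi> \<theta>\<^sub>0 - b * (y - \<theta>\<^sub>0)\<bar> \<le> e * \<bar>y - \<theta>\<^sub>0\<bar>"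
    using deriv e(1) unfolding has_field_derivative_def has_derivative_at_alt by fastforce
  have "(\<lambda>n. 0 + H / sqrt (real n)) \<longlonglongrightarrow> 0"
    by (rule local_parameter_tendsto)
  then have "\<forall>\<^sub>F n in sequentially. H / sqrt (real n) < d"
    using d by (intro order_tendstoD(2)) auto
  then show ?thesis
    using eventually_gt_at_top[of 0]
  proof eventually_elim
    case (elim n)
    show ?case
    proof (intro allI impI)
      fix h :: real assume h: "\<bar>h\<bar> \<le> H"
      have n: "0 < sqrt (real n)" using elim by simp
      have "\<bar>h\<bar> / sqrt (real n) < d"
        using divide_right_mono[OF h, of "sqrt (real n)"] elim(1) n by linarith
      then have "\<bar>\<psi> (\<theta>\<^sub>0 + h / sqrt (real n)) - \<psi> \<theta>\<^sub>0 - b * (h / sqrt (real n))\<bar> \<le> e * (\<bar>h\<bar> / sqrt (real n))"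
        using near[of "\<theta>\<^sub>0 + h / sqrt (real n)"] by simp
      then have "sqrt (real n) * \<bar>\<psi> (\<theta>\<^sub>0 + h / sqrt (real n)) - \<psi> \<theta>\<^sub>0 - b * (h / sqrt (real n))\<bar>
          \<le> sqrt (real n) * (e * (\<bar>h\<bar> / sqrt (real n)))"
        using n by (intro mult_left_mono) auto
      also have "\<dots> \<le> \<epsilon>"
      proof -
        have "e * \<bar>h\<bar> \<le> \<epsilon>"
          using e(1) by (intro order_trans[OF mult_left_mono[OF h] e(2)]) simp
        then show ?thesis using n by simp
      qed
      also have "sqrt (real n) * \<bar>\<psi> (\<theta>\<^sub>0 + h / sqrt (real n)) - \<psi> \<theta>\<^sub>0 - b * (h / sqrt (real n))\<bar> =
          \<bar>sqrt (real n) * (\<psi> (\<theta>\<^sub>0 + h / sqrt (real n)) - \<psi> \<theta>\<^sub>0 - b * (h / sqrt (real n)))\<bar>"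
        using n by (simp add: abs_mult)
      also have "sqrt (real n) * (\<psi> (\<theta>\<^sub>0 + h / sqrt (real n)) - \<psi> \<theta>\<^sub>0 - b * (h / sqrt (real n)))
          = local_target \<psi> \<theta>\<^sub>0 n h - b * h"
        using n by (simp add: local_target_def right_diff_distrib)
      finally show "\<bar>local_target \<psi> \<theta>\<^sub>0 n h - b * h\<bar> \<le> \<epsilon>" .
    qed
  qed
qed

lemma liminf_risk_le_limit_risk:
  "liminf (\<lambda>n. local_minimax_risk \<Theta> \<theta>\<^sub>0 Y E \<psi> V n H) \<le> limit_risk \<Theta> \<theta>\<^sub>0 Y E \<psi> V"
proof (rule tendsto_lowerbound[OF tendsto_limit_risk])
  show "\<forall>\<^sub>F H' in at_top. liminf (\<lambda>n. local_minimax_risk \<Theta> \<theta>\<^sub>0 Y E \<psi> V n H)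
      \<le> liminf (\<lambda>n. local_minimax_risk \<Theta> \<theta>\<^sub>0 Y E \<psi> V n H')"
    using eventually_ge_at_top[of H]
    by eventually_elim (intro Liminf_mono always_eventually allI local_minimax_risk_mono)
qed simp

text \<open>Turns the Blackwell order into affinities: a garbled experiment separates two parameters
  no better than its source does.\<close>

lemma blackwell_affinity_ge:
  assumes ge: "blackwell_ge \<Theta> M E N G" and E: "statistical_experiment \<Theta> M E"
    and \<theta>: "\<theta> \<in> \<Theta>" "\<theta>' \<in> \<Theta>" and aff: "affinity_ge M (E \<theta>) (E \<theta>') \<rho>"
  shows "affinity_ge N (G \<theta>) (G \<theta>') \<rho>"
proof -
  obtain K where K: "K \<in> M \<rightarrow>\<^sub>M prob_algebra N" and G: "\<And>\<theta>. \<theta> \<in> \<Theta> \<Longrightarrow> G \<theta> = E \<theta> \<bind> K"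
    using ge unfolding blackwell_ge_def by blast
  have "E \<theta> \<in> space (prob_algebra M)" "E \<theta>' \<in> space (prob_algebra M)"
    using E \<theta> by (auto simp: statistical_experiment_def)
  from affinity_ge_bind[OF aff this K] show ?thesis
    unfolding G[OF \<theta>(1)] G[OF \<theta>(2)] .
qed

text \<open>The grid has \<open>m ^ 3\<close> points at distance \<open>1 / m\<close>: the mesh tends to \<open>0\<close> while the grid
  extends to infinity so fast that the end points of the prior become negligible.\<close>

lemma grid_information_bound:
  assumes \<theta>\<^sub>0: "\<theta>\<^sub>0 \<in> interior \<Theta>" and V: "finite V" and a: "a \<in> V"
    and E: "\<And>a. a \<in> V \<Longrightarrow> statistical_experiment \<Theta> (Y a) (E a)"
    and ge: "\<And>a'. a' \<in> V \<Longrightarrow> blackwell_ge \<Theta> (Y a) (E a) (Y a') (E a')"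
    and dqm: "dqm_at \<Theta> (Y a) (E a) \<theta>\<^sub>0 J"
    and deriv: "(\<psi> has_real_derivative b) (at \<theta>\<^sub>0)"
    and risk: "limit_risk \<Theta> \<theta>\<^sub>0 Y E \<psi> V < ennreal x" and m: "0 < m"
  defines "e \<equiv> 1 / real m"
  shows "b\<^sup>2 \<le> (8 * e + (J + e)) * ((1 + e) * x + e\<^sup>2 + e + b\<^sup>2 * e\<^sup>2 / 4)"
proof -
  have x: "0 < x"
    using risk by (metis ennreal_neg leI not_less_zero)
  have e: "0 < e" using m by (simp add: e_def)
  have J: "0 \<le> J" by (rule dqm_information_nonneg[OF dqm])
  define N where "N = m ^ 3"
  have N: "0 < N" using m by (simp add: N_def)
  define H where "H = N * e"
  \<comment> \<open>The grid starts at \<open>e\<close> rather than 0 because the local affinity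
    bound is available for nonzero parameters only.\<close>
  define t where "t = (\<lambda>j. real (Suc j) * e)"
  have t: "t j \<noteq> 0" "t j - t (Suc j) = - e" for j
    using e by (simp add: t_def) (simp add: t_def algebra_simps)
  have tH: "\<bar>t j\<bar> \<le> H" if "j < N" for j
    using that e by (auto simp: t_def H_def intro!: mult_right_mono)
  \<comment> \<open>Gives \<open>8 * c = e\<^sup>2 * (J + e)\<close>: the slack is of smaller order
    than the squared mesh.\<close>
  define \<kappa> where "\<kappa> = e\<^sup>2 * e / 8"
  have \<kappa>: "0 < \<kappa>" using e by (simp add: \<kappa>_def)
  define c where "c = J * e\<^sup>2 / 8 + \<kappa>"
  have c: "0 < c" using J \<kappa> by (simp add: c_def add_nonneg_pos)
  have "liminf (\<lambda>n. local_minimax_risk \<Theta> \<theta>\<^sub>0 Y E \<psi> V n H) < ennreal x"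
    by (rule le_less_trans[OF liminf_risk_le_limit_risk risk])
  \<comment> \<open>The liminf yields a small risk for infinitely many \<open>n\<close> only; all
    other requirements hold eventually, so some \<open>n\<close> meets them together.\<close>
  then have "\<exists>\<^sub>F n in sequentially. local_minimax_risk \<Theta> \<theta>\<^sub>0 Y E \<psi> V n H < ennreal x"
    unfolding frequently_def not_less using Liminf_bounded by (metis not_less)
  then have freq: "\<exists>\<^sub>F n in sequentially. local_minimax_risk \<Theta> \<theta>\<^sub>0 Y E \<psi> V n H < ennreal x" .
  have "\<forall>\<^sub>F n in sequentially. \<forall>j\<in>{..<N}.
      affinity_ge (Y a) (E a (\<theta>\<^sub>0 + t j / sqrt (real n))) (E a (\<theta>\<^sub>0 + t (Suc j) / sqrt (real n))) (1 - c / n)"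
  proof (intro eventually_ball_finite ballI)
    fix j
    show "\<forall>\<^sub>F n in sequentially.
      affinity_ge (Y a) (E a (\<theta>\<^sub>0 + t j / sqrt (real n))) (E a (\<theta>\<^sub>0 + t (Suc j) / sqrt (real n))) (1 - c / n)"
      using dqm_eventually_affinity_ge[OF \<theta>\<^sub>0 E[OF a] dqm t(1)[of j] t(1)[of "Suc j"] \<kappa>]
      by (simp add: t(2) c_def)
  qed simp
  moreover have "\<forall>\<^sub>F n in sequentially. \<forall>j\<in>{..<N}. \<theta>\<^sub>0 + t j / sqrt (real n) \<in> \<Theta>"
    using eventually_local_parameter_in[OF \<theta>\<^sub>0] by (intro eventually_ball_finite) auto
  moreover have "\<forall>\<^sub>F n in sequentially. \<forall>h. \<bar>h\<bar> \<le> H \<longrightarrow> \<bar>local_target \<psi> \<theta>\<^sub>0 n h - b * h\<bar> \<le> e"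
    using e by (intro eventually_local_target_near[OF deriv]) (auto simp: H_def)
  moreover have "\<forall>\<^sub>F n in sequentially. c < real n"
    using filterlim_real_sequentially by (simp add: filterlim_at_top_dense)
  ultimately have "\<forall>\<^sub>F n in sequentially.
      (\<forall>j\<in>{..<N}. affinity_ge (Y a) (E a (\<theta>\<^sub>0 + t j / sqrt (real n))) (E a (\<theta>\<^sub>0 + t (Suc j) / sqrt (real n))) (1 - c / n)) \<and>
      (\<forall>j\<in>{..<N}. \<theta>\<^sub>0 + t j / sqrt (real n) \<in> \<Theta>) \<and>
      (\<forall>h. \<bar>h\<bar> \<le> H \<longrightarrow> \<bar>local_target \<psi> \<theta>\<^sub>0 n h - b * h\<bar> \<le> e) \<and> c < real n"
    by (intro eventually_conj)
  from frequently_ex[OF frequently_eventually_conj[OF freq this]]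
  obtain n where n: "local_minimax_risk \<Theta> \<theta>\<^sub>0 Y E \<psi> V n H < ennreal x"
    and aff: "\<And>j. j < N \<Longrightarrow> affinity_ge (Y a) (E a (\<theta>\<^sub>0 + t j / sqrt (real n))) (E a (\<theta>\<^sub>0 + t (Suc j) / sqrt (real n))) (1 - c / n)"
    and \<Theta>: "\<And>j. j < N \<Longrightarrow> \<theta>\<^sub>0 + t j / sqrt (real n) \<in> \<Theta>"
    and near: "\<And>h. \<bar>h\<bar> \<le> H \<Longrightarrow> \<bar>local_target \<psi> \<theta>\<^sub>0 n h - b * h\<bar> \<le> e"
    and cn: "c < real n"
    by auto
  define \<rho> where "\<rho> = 1 - c / n"
  have \<rho>: "0 < \<rho>" "\<rho> \<le> 1"
    using c cn by (auto simp: \<rho>_def field_simps)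
  have \<rho>n: "0 \<le> \<rho> ^ n" "\<rho> ^ n \<le> 1"
    using \<rho> by (auto intro: power_le_one)
  \<comment> \<open>Bernoulli's inequality bounds the loss over \<open>n\<close> stages by
    \<open>c\<close> for each \<open>n > c\<close>, so no exponential limit appears.\<close>
  have "1 + n * (- c / n) \<le> (1 + - c / n) ^ n"
    using c cn by (intro Bernoulli_inequality) (simp add: field_simps)
  then have bernoulli: "1 - \<rho> ^ n \<le> c"
    using c cn by (simp add: \<rho>_def)
  obtain \<pi> T where \<pi>: "\<pi> \<in> menu_policies Y V n" and T: "T \<in> borel_measurable (record_space Y V n)"
    and sup: "(SUP h \<in> local_params \<Theta> \<theta>\<^sub>0 n H.
          \<integral>\<^sup>+ w. ennreal ((T w - local_target \<psi> \<theta>\<^sub>0 n h)\<^sup>2)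
            \<partial>record_law Y V \<pi> (\<lambda>a. E a (\<theta>\<^sub>0 + h / sqrt (real n))) n) < ennreal x"
    using n unfolding local_minimax_risk_def by (auto simp: INF_less_iff)
  define R where "R = (\<lambda>j. record_law Y V \<pi> (\<lambda>a. E a (\<theta>\<^sub>0 + t j / sqrt (real n))) n)"
  have EV: "E a' (\<theta>\<^sub>0 + t j / sqrt (real n)) \<in> space (prob_algebra (Y a'))" if "a' \<in> V" "j < N" for a' j
    using E[OF that(1)] \<Theta>[OF that(2)] by (auto simp: statistical_experiment_def)
  have R: "R j \<in> space (prob_algebra (record_space Y V n))" if "j < N" for j
    unfolding R_def using EV that by (intro record_law_in_prob_algebra[OF V _ \<pi>]) auto
  have affR: "affinity_ge (record_space Y V n) (R j) (R (Suc j)) (\<rho> ^ n)" if j: "Suc j < N" for j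
    unfolding R_def
  proof (rule affinity_ge_record_law[OF V _ _ _ \<rho>(1) \<pi>])
    fix a' assume a': "a' \<in> V"
    show "affinity_ge (Y a') (E a' (\<theta>\<^sub>0 + t j / sqrt (real n))) (E a' (\<theta>\<^sub>0 + t (Suc j) / sqrt (real n))) \<rho>"
      using j aff[of j] \<Theta>[of j] \<Theta>[of "Suc j"] unfolding \<rho>_def
      by (intro blackwell_affinity_ge[OF ge[OF a'] E[OF a]]) auto
  qed (use EV j in auto)
  have loss: "integrable (R j) (\<lambda>w. (T w)\<^sup>2)" "(\<integral>w. (T w - (b * e + b * e * j))\<^sup>2 \<partial>R j) \<le> (1 + e) * x + e\<^sup>2 + e"
    if j: "j < N" for j
  proof -
    have "t j \<in> local_params \<Theta> \<theta>\<^sub>0 n H"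
      using tH[OF j] \<Theta>[OF j] by (simp add: local_params_def)
    then have le: "(\<integral>\<^sup>+ w. ennreal ((T w - local_target \<psi> \<theta>\<^sub>0 n (t j))\<^sup>2) \<partial>R j) \<le> ennreal x"
      unfolding R_def using sup by (intro less_imp_le[OF le_less_trans[OF SUP_upper sup]])
    have "b * t j = b * e + b * e * j"
      by (simp add: t_def algebra_simps)
    then show "integrable (R j) (\<lambda>w. (T w)\<^sup>2)" "(\<integral>w. (T w - (b * e + b * e * j))\<^sup>2 \<partial>R j) \<le> (1 + e) * x + e\<^sup>2 + e"
      using target_perturbation[OF R[OF j] T le less_imp_le[OF x] e near[OF tH[OF j]]] by auto
  qed
  \<comment> \<open>First target and increment are both \<open>b * e\<close>, since the linearised
    target at \<open>t j\<close> is \<open>b * e * (j + 1)\<close>.\<close>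
  have "(b * e)\<^sup>2 \<le> (8 / N + 8 * (1 - \<rho> ^ n)) * ((1 + e) * x + e\<^sup>2 + e + (b * e)\<^sup>2 / 4)"
    by (rule chain_risk_bound[OF N R affR \<rho>n T loss])
  also have "\<dots> \<le> (8 / N + 8 * c) * ((1 + e) * x + e\<^sup>2 + e + (b * e)\<^sup>2 / 4)"
    using bernoulli x e by (intro mult_right_mono) (auto intro!: add_nonneg_nonneg)
  \<comment> \<open>As \<open>1 / N = e ^ 3\<close>, both summands contain \<open>e\<^sup>2\<close>,
    which cancels against the factor in \<open>(b * e)\<^sup>2\<close>.\<close>
  also have "8 / N + 8 * c = e\<^sup>2 * (8 * e + (J + e))"
    using m by (simp add: N_def c_def \<kappa>_def e_def field_simps power2_eq_square power3_eq_cube)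
  finally have "e\<^sup>2 * b\<^sup>2 \<le> e\<^sup>2 * ((8 * e + (J + e)) * ((1 + e) * x + e\<^sup>2 + e + b\<^sup>2 * e\<^sup>2 / 4))"
    by (simp add: power_mult_distrib ac_simps)
  then show ?thesis
    using e by simp
qed

text \<open>The mesh of the grid bound tends to 0. The form without division also covers
  \<open>J = 0\<close>, where a finite risk forces \<open>b = 0\<close>.\<close>

lemma limit_risk_information_bound:
  assumes "\<theta>\<^sub>0 \<in> interior \<Theta>" "finite V" "a \<in> V"
    and "\<And>a. a \<in> V \<Longrightarrow> statistical_experiment \<Theta> (Y a) (E a)"
    and "\<And>a'. a' \<in> V \<Longrightarrow> blackwell_ge \<Theta> (Y a) (E a) (Y a') (E a')"
    and "dqm_at \<Theta> (Y a) (E a) \<theta>\<^sub>0 J"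
    and "(\<psi> has_real_derivative b) (at \<theta>\<^sub>0)"
    and "limit_risk \<Theta> \<theta>\<^sub>0 Y E \<psi> V < ennreal x"
  shows "b\<^sup>2 \<le> J * x"
proof -
  have "(\<lambda>m. (8 * (1 / real m) + (J + 1 / real m)) *
      ((1 + 1 / real m) * x + (1 / real m)\<^sup>2 + 1 / real m + b\<^sup>2 * (1 / real m)\<^sup>2 / 4)) \<longlonglongrightarrow>
      (8 * 0 + (J + 0)) * ((1 + 0) * x + 0\<^sup>2 + 0 + b\<^sup>2 * 0\<^sup>2 / 4)"
    by (intro tendsto_intros lim_1_over_n) auto
  then have "b\<^sup>2 \<le> (8 * 0 + (J + 0)) * ((1 + 0) * x + 0\<^sup>2 + 0 + b\<^sup>2 * 0\<^sup>2 / 4)"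
    by (rule LIMSEQ_le_const) (use grid_information_bound[OF assms] in \<open>auto intro!: exI[of _ 1]\<close>)
  then show ?thesis by simp
qed

section \<open>Upper bound\<close>

lemma sets_stage:
  assumes "a \<in> V" "B \<in> sets (Y a)"
  shows "{a} \<times> B \<in> sets (stage_space Y V)"
proof -
  have "{{a} \<times> B |a B. a \<in> V \<and> B \<in> sets (Y a)} \<subseteq> Pow (SIGMA a:V. space (Y a))"
    by (auto dest: sets.sets_into_space)
  then show ?thesis
    using assms unfolding stage_space_def by auto
qed

lemma space_stage: "space (stage_space Y V) = (SIGMA a:V. space (Y a))"
  unfolding stage_space_def by (rule space_measure_of) (auto dest: sets.sets_into_space)

text \<open>Outcomes of actions other than \<open>a\<close> need not lie in the sample space of \<open>a\<close>, hence the
  default value \<open>y\<^sub>0\<close>.\<close>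

definition stage_outcome :: "'a \<Rightarrow> 'y \<Rightarrow> 'a \<times> 'y \<Rightarrow> 'y" where
  "stage_outcome a y\<^sub>0 p = (if fst p = a then snd p else y\<^sub>0)"

definition record_outcomes :: "'a \<Rightarrow> 'y \<Rightarrow> nat \<Rightarrow> (nat \<Rightarrow> 'a \<times> 'y) \<Rightarrow> nat \<Rightarrow> 'y" where
  "record_outcomes a y\<^sub>0 n w = (\<lambda>i\<in>{..<n}. stage_outcome a y\<^sub>0 (w i))"

lemma measurable_stage_outcome:
  assumes V: "finite V" and a: "a \<in> V" and y0: "y\<^sub>0 \<in> space (Y a)"
  shows "stage_outcome a y\<^sub>0 \<in> stage_space Y V \<rightarrow>\<^sub>M Y a"
proof (rule measurableI)
  fix p assume "p \<in> space (stage_space Y V)"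
  then show "stage_outcome a y\<^sub>0 p \<in> space (Y a)"
    using y0 by (auto simp: space_stage stage_outcome_def)
next
  fix B assume B: "B \<in> sets (Y a)"
  have "stage_outcome a y\<^sub>0 -` B \<inter> space (stage_space Y V) =
     {a} \<times> B \<union> (\<Union>a'\<in>V - {a}. {a'} \<times> (if y\<^sub>0 \<in> B then space (Y a') else {}))"
    using a B[THEN sets.sets_into_space] by (auto simp: space_stage stage_outcome_def split: if_splits)
  also have "\<dots> \<in> sets (stage_space Y V)"
    using a B V by (intro sets.Un sets.finite_UN sets_stage) auto
  finally show "stage_outcome a y\<^sub>0 -` B \<inter> space (stage_space Y V) \<in> sets (stage_space Y V)" .
qed

lemma measurable_record_outcomes:
  assumes "finite V" "a \<in> V" "y\<^sub>0 \<in> space (Y a)"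
  shows "record_outcomes a y\<^sub>0 n \<in> record_space Y V n \<rightarrow>\<^sub>M PiM {..<n} (\<lambda>_. Y a)"
proof -
  have "stage_outcome a y\<^sub>0 \<in> stage_space Y V \<rightarrow>\<^sub>M Y a"
    using assms by (rule measurable_stage_outcome)
  then show ?thesis
    unfolding record_outcomes_def record_space_def
    by (intro measurable_restrict measurable_compose[OF measurable_component_singleton])
qed

lemma record_outcomes_Suc:
  "record_outcomes a y\<^sub>0 (Suc n) (w(n := (a, y))) = (record_outcomes a y\<^sub>0 n w)(n := y)"
  by (auto simp: record_outcomes_def stage_outcome_def restrict_def fun_eq_iff)

lemma constant_policy_in_menu_policies:
  "a \<in> V \<Longrightarrow> (\<lambda>_ _. return (count_space V) a) \<in> menu_policies Y V n"
  by (auto simp: menu_policies_def intro!: measurable_const simp: space_prob_algebra prob_space_return)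

text \<open>Under a constant policy every stage carries the action \<open>a\<close>, so the default
  \<open>y\<^sub>0\<close> does not enter, and removing the last stage of the record matches
  removing the last coordinate of the product measure.\<close>

lemma nn_integral_constant_policy:
  assumes V: "finite V" and a: "a \<in> V" and y0: "y\<^sub>0 \<in> space (Y a)"
    and F: "\<And>a. a \<in> V \<Longrightarrow> F a \<in> space (prob_algebra (Y a))"
    and f: "f \<in> borel_measurable (PiM {..<n} (\<lambda>_. Y a))"
  shows "(\<integral>\<^sup>+w. f (record_outcomes a y\<^sub>0 n w) \<partial>record_law Y V (\<lambda>_ _. return (count_space V) a) F n) =
     (\<integral>\<^sup>+x. f x \<partial>PiM {..<n} (\<lambda>_. F a))"
  using f
proof (induction n arbitrary: f)
  case 0
  interpret product_sigma_finite "\<lambda>_ :: nat. F a"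
    using F[OF a] by (auto simp: product_sigma_finite_def space_prob_algebra intro: prob_space_imp_sigma_finite)
  have "record_outcomes a y\<^sub>0 0 w = (\<lambda>_. undefined)" for w
    by (simp add: record_outcomes_def restrict_def)
  then have "(\<integral>\<^sup>+w. f (record_outcomes a y\<^sub>0 0 w) \<partial>record_law Y V (\<lambda>_ _. return (count_space V) a) F 0)
     = (\<integral>\<^sup>+w. f (\<lambda>_. undefined) \<partial>return (record_space Y V 0) (\<lambda>_. undefined))"
    by simp
  also have "\<dots> = f (\<lambda>_. undefined)"
    by (subst nn_integral_return) (auto simp: record_space_def space_PiM)
  finally show ?case
    by (simp add: PiM_empty nn_integral_count_space_finite)
next
  case (Suc n)
  let ?\<pi> = "\<lambda>_ _. return (count_space V) a" and ?o = "record_outcomes a y\<^sub>0"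
  interpret Fa: prob_space "F a" using F[OF a] by (simp add: space_prob_algebra)
  interpret product_sigma_finite "\<lambda>_ :: nat. F a"
    by (auto simp: product_sigma_finite_def intro: Fa.sigma_finite_measure)
  have setF: "sets (F a) = sets (Y a)" using F[OF a] by (simp add: space_prob_algebra)
  have setP: "sets (PiM A (\<lambda>_. F a)) = sets (PiM A (\<lambda>_. Y a))" for A :: "nat set"
    using setF by (intro sets_PiM_cong) auto
  have f: "f \<in> borel_measurable (PiM (insert n {..<n}) (\<lambda>_. Y a))"
    using Suc.prems by (simp add: lessThan_Suc)
  have \<pi>: "?\<pi> \<in> menu_policies Y V (Suc n)"
    by (rule constant_policy_in_menu_policies[OF a])
  let ?G = "\<lambda>x. \<integral>\<^sup>+y. f (x(n := y)) \<partial>F a"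
  have "(\<lambda>p. f ((\<lambda>(x, y). x(n := y)) p)) \<in> borel_measurable (PiM {..<n} (\<lambda>_. Y a) \<Otimes>\<^sub>M Y a)"
    by (rule measurable_compose[OF measurable_add_dim f])
  then have "(\<lambda>(x, y). f (x(n := y))) \<in> borel_measurable (PiM {..<n} (\<lambda>_. Y a) \<Otimes>\<^sub>M F a)"
    using setF by (simp add: split_beta' cong: measurable_cong_sets sets_pair_measure_cong)
  then have G: "?G \<in> borel_measurable (PiM {..<n} (\<lambda>_. Y a))"
    by (rule Fa.borel_measurable_nn_integral)
  have fo: "(\<lambda>w. f (?o (Suc n) w)) \<in> borel_measurable (record_space Y V (Suc n))"
    by (rule measurable_compose[OF measurable_record_outcomes[where Y=Y, OF V a y0] Suc.prems])
  have "(\<integral>\<^sup>+w. f (?o (Suc n) w) \<partial>record_law Y V ?\<pi> F (Suc n)) =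
      (\<integral>\<^sup>+w. \<integral>\<^sup>+a'. \<integral>\<^sup>+y. f (?o (Suc n) (w(n := (a', y)))) \<partial>F a' \<partial>return (count_space V) a \<partial>record_law Y V ?\<pi> F n)"
    using nn_integral_record_law_Suc(1)[OF V F \<pi> _ fo] by simp
  also have "\<dots> = (\<integral>\<^sup>+w. \<integral>\<^sup>+y. f (?o (Suc n) (w(n := (a, y)))) \<partial>F a \<partial>record_law Y V ?\<pi> F n)"
    using a by (simp add: nn_integral_return)
  also have "\<dots> = (\<integral>\<^sup>+w. ?G (?o n w) \<partial>record_law Y V ?\<pi> F n)"
    by (simp add: record_outcomes_Suc)
  also have "\<dots> = (\<integral>\<^sup>+x. ?G x \<partial>PiM {..<n} (\<lambda>_. F a))"
    by (rule Suc.IH[OF G])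
  also have "\<dots> = (\<integral>\<^sup>+x. f x \<partial>PiM (insert n {..<n}) (\<lambda>_. F a))"
    using f setP by (intro product_nn_integral_insert[symmetric]) (auto cong: measurable_cong_sets)
  finally show ?case
    by (simp add: lessThan_Suc)
qed

section \<open>Risk bounds from estimators based on a single action\<close>

lemma limit_risk_leI:
  assumes "\<And>H. 0 \<le> H \<Longrightarrow> liminf (\<lambda>n. local_minimax_risk \<Theta> \<theta>\<^sub>0 Y E \<psi> V n H) \<le> C"
  shows "limit_risk \<Theta> \<theta>\<^sub>0 Y E \<psi> V \<le> C"
proof (rule tendsto_upperbound[OF tendsto_limit_risk])
  show "\<forall>\<^sub>F H in at_top. liminf (\<lambda>n. local_minimax_risk \<Theta> \<theta>\<^sub>0 Y E \<psi> V n H) \<le> C"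
    using eventually_ge_at_top[of 0] by eventually_elim (rule assms)
qed simp

text \<open>An infinite \<open>X\<close> would be at infinite distance from \<open>c\<close>, so the
  hypothesis already makes \<open>X\<close> finite.\<close>

lemma ennreal_le_of_ereal_dist:
  assumes "\<bar>enn2ereal X - ereal c\<bar> < ereal \<epsilon>" "0 \<le> c"
  shows "X \<le> ennreal (c + \<epsilon>)"
  using assms by (cases X) (auto simp: enn2ereal_ennreal simp del: ennreal_plus intro!: ennreal_leI)

lemma local_minimax_risk_le:
  assumes V: "finite V" and a: "a \<in> V"
    and E: "\<And>a. a \<in> V \<Longrightarrow> statistical_experiment \<Theta> (Y a) (E a)"
    and est: "est \<in> borel_measurable (PiM {..<n} (\<lambda>_. Y a))"
    and le: "\<And>h. h \<in> local_params \<Theta> \<theta>\<^sub>0 n H \<Longrightarrow>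
      (\<integral>\<^sup>+x. ennreal ((est x - local_target \<psi> \<theta>\<^sub>0 n h)\<^sup>2) \<partial>PiM {..<n} (\<lambda>_. E a (\<theta>\<^sub>0 + h / sqrt (real n)))) \<le> C"
  shows "local_minimax_risk \<Theta> \<theta>\<^sub>0 Y E \<psi> V n H \<le> C"
\<comment> \<open>With no admissible parameter the supremum is 0. Otherwise there is a probability
  law on \<open>Y a\<close>, so its space has a point to serve as the default outcome.\<close>
proof (cases "local_params \<Theta> \<theta>\<^sub>0 n H = {}")
  case True
  have "local_minimax_risk \<Theta> \<theta>\<^sub>0 Y E \<psi> V n H \<le> 0"
    unfolding local_minimax_risk_def
    by (rule INF_lower2[of "(\<lambda>_ _. return (count_space V) a, \<lambda>_. 0)"])
      (auto simp: True constant_policy_in_menu_policies[OF a] bot_ennreal)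
  then show ?thesis by simp
next
  case False
  then obtain h where "\<theta>\<^sub>0 + h / sqrt (real n) \<in> \<Theta>" by (auto simp: local_params_def)
  then have "E a (\<theta>\<^sub>0 + h / sqrt (real n)) \<in> space (prob_algebra (Y a))"
    using E[OF a] by (auto simp: statistical_experiment_def)
  then have "space (Y a) \<noteq> {}"
    using prob_space.not_empty sets_eq_imp_space_eq unfolding space_prob_algebra by blast
  then obtain y0 where y0: "y0 \<in> space (Y a)" by auto
  let ?\<pi> = "\<lambda>_ _. return (count_space V) a" and ?T = "\<lambda>w. est (record_outcomes a y0 n w)"
  have T: "?T \<in> borel_measurable (record_space Y V n)"
    by (rule measurable_compose[OF measurable_record_outcomes[where Y=Y, OF V a y0] est])
  show ?thesis
    unfolding local_minimax_risk_def
  proof (rule INF_lower2[of "(?\<pi>, ?T)"])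
    show "(?\<pi>, ?T) \<in> menu_policies Y V n \<times> borel_measurable (record_space Y V n)"
      using T constant_policy_in_menu_policies[OF a] by auto
    have "(\<integral>\<^sup>+w. ennreal ((?T w - local_target \<psi> \<theta>\<^sub>0 n h)\<^sup>2) \<partial>record_law Y V ?\<pi> (\<lambda>a. E a (\<theta>\<^sub>0 + h / sqrt (real n))) n) \<le> C"
      if h: "h \<in> local_params \<Theta> \<theta>\<^sub>0 n H" for h
    proof -
      have "E a' (\<theta>\<^sub>0 + h / sqrt (real n)) \<in> space (prob_algebra (Y a'))" if "a' \<in> V" for a'
        using E[OF that] h by (auto simp: statistical_experiment_def local_params_def)
      then show ?thesis
        using le[OF h] est
        by (subst nn_integral_constant_policy[where Y=Y and f="\<lambda>x. ennreal ((est x - local_target \<psi> \<theta>\<^sub>0 n h)\<^sup>2)", OF V a y0]) auto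
    qed
    then show "(case (?\<pi>, ?T) of (\<pi>, T) \<Rightarrow> SUP h \<in> local_params \<Theta> \<theta>\<^sub>0 n H.
          \<integral>\<^sup>+ w. ennreal ((T w - local_target \<psi> \<theta>\<^sub>0 n h)\<^sup>2)
            \<partial>record_law Y V \<pi> (\<lambda>a. E a (\<theta>\<^sub>0 + h / sqrt (real n))) n) \<le> C"
      by (auto intro!: SUP_least)
  qed
qed

lemma prob_space_local_product:
  assumes E: "statistical_experiment \<Theta> M E" and h: "h \<in> local_params \<Theta> \<theta>\<^sub>0 n H"
  shows "PiM {..<n} (\<lambda>_. E (\<theta>\<^sub>0 + h / sqrt (real n))) \<in> space (prob_algebra (PiM {..<n} (\<lambda>_. M)))"
proof -
  have "E (\<theta>\<^sub>0 + h / sqrt (real n)) \<in> space (prob_algebra M)"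
    using E h by (auto simp: statistical_experiment_def local_params_def)
  then have "sets (E (\<theta>\<^sub>0 + h / sqrt (real n))) = sets M" "prob_space (E (\<theta>\<^sub>0 + h / sqrt (real n)))"
    by (auto simp: space_prob_algebra)
  then show ?thesis
    unfolding space_prob_algebra by (intro CollectI conjI prob_space_PiM sets_PiM_cong) auto
qed

text \<open>A flat target is estimated by the constant 0: the local target stays within
  \<open>e\<close> of \<open>0 * h\<close>, uniformly on \<open>\<bar>h\<bar> \<le> H\<close>, for
  all large \<open>n\<close>.\<close>

lemma limit_risk_zero:
  assumes V: "finite V" and a: "a \<in> V"
    and E: "\<And>a. a \<in> V \<Longrightarrow> statistical_experiment \<Theta> (Y a) (E a)"
    and deriv: "(\<psi> has_real_derivative 0) (at \<theta>\<^sub>0)"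
  shows "limit_risk \<Theta> \<theta>\<^sub>0 Y E \<psi> V = 0"
proof -
  have "limit_risk \<Theta> \<theta>\<^sub>0 Y E \<psi> V \<le> ennreal (e\<^sup>2)" if e: "0 < e" for e
  proof (rule limit_risk_leI)
    fix H :: real assume H: "0 \<le> H"
    have "\<forall>\<^sub>F n in sequentially. local_minimax_risk \<Theta> \<theta>\<^sub>0 Y E \<psi> V n H \<le> ennreal (e\<^sup>2)"
      using eventually_local_target_near[OF deriv e H]
    proof eventually_elim
      case (elim n)
      show ?case
      proof (rule local_minimax_risk_le[OF V a E, where est="\<lambda>_. 0"])
        fix h assume h: "h \<in> local_params \<Theta> \<theta>\<^sub>0 n H"
        then have "\<bar>local_target \<psi> \<theta>\<^sub>0 n h\<bar> \<le> e"
          using elim by (auto simp: local_params_def)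
        then have "(local_target \<psi> \<theta>\<^sub>0 n h)\<^sup>2 \<le> e\<^sup>2"
          using e by (simp add: abs_le_square_iff[symmetric])
        then show "(\<integral>\<^sup>+x. ennreal ((0 - local_target \<psi> \<theta>\<^sub>0 n h)\<^sup>2) \<partial>PiM {..<n} (\<lambda>_. E a (\<theta>\<^sub>0 + h / sqrt (real n)))) \<le> ennreal (e\<^sup>2)"
          using prob_space_local_product[OF E[OF a] h]
          by (simp add: space_prob_algebra prob_space.emeasure_space_1 ennreal_leI)
      qed auto
    qed
    then show "liminf (\<lambda>n. local_minimax_risk \<Theta> \<theta>\<^sub>0 Y E \<psi> V n H) \<le> ennreal (e\<^sup>2)"
      by (intro Liminf_le) auto
  qed
  then have "limit_risk \<Theta> \<theta>\<^sub>0 Y E \<psi> V \<le> 0 + ennreal e" if "0 < e" for e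
    using that by (metis add_0 real_sqrt_gt_0_iff real_sqrt_pow2 less_imp_le)
  then have "limit_risk \<Theta> \<theta>\<^sub>0 Y E \<psi> V \<le> 0"
    by (rule ennreal_le_epsilon)
  then show ?thesis by simp
qed

text \<open>The plug-in \<open>b * sqrt n * (est - \<theta>\<^sub>0)\<close> has \<open>b\<close>
  times the rescaled error of the efficient estimator, up to a linearisation error that Young's
  inequality separates.\<close>

lemma limit_risk_le_inverse_information:
  assumes V: "finite V" and a: "a \<in> V"
    and E: "\<And>a. a \<in> V \<Longrightarrow> statistical_experiment \<Theta> (Y a) (E a)"
    and eff: "has_efficient_estimator \<Theta> (Y a) (E a) \<theta>\<^sub>0 J" and J: "0 < J"
    and deriv: "(\<psi> has_real_derivative b) (at \<theta>\<^sub>0)"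
  shows "limit_risk \<Theta> \<theta>\<^sub>0 Y E \<psi> V \<le> ennreal (b\<^sup>2 / J)"
proof -
  obtain est where est[measurable]: "\<And>n. est n \<in> borel_measurable (PiM {..<n} (\<lambda>_. Y a))"
    and lim: "\<And>H. 0 \<le> H \<Longrightarrow> (\<lambda>n. SUP h \<in> local_params \<Theta> \<theta>\<^sub>0 n H.
            \<bar>enn2ereal (\<integral>\<^sup>+ y. ennreal (real n * (est n y - (\<theta>\<^sub>0 + h / sqrt (real n)))\<^sup>2) \<partial>PiM {..<n} (\<lambda>_. E a (\<theta>\<^sub>0 + h / sqrt (real n))))
              - ereal (1 / J)\<bar>) \<longlonglongrightarrow> 0"
    using eff unfolding has_efficient_estimator_def Let_def by blast
  have bound: "limit_risk \<Theta> \<theta>\<^sub>0 Y E \<psi> V \<le> ennreal ((1 + e) * b\<^sup>2 * (1 / J + e) + (e\<^sup>2 + e))" if e: "0 < e" for e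
  proof (rule limit_risk_leI)
    fix H :: real assume H: "0 \<le> H"
    have "\<forall>\<^sub>F n in sequentially. (SUP h \<in> local_params \<Theta> \<theta>\<^sub>0 n H.
            \<bar>enn2ereal (\<integral>\<^sup>+ y. ennreal (real n * (est n y - (\<theta>\<^sub>0 + h / sqrt (real n)))\<^sup>2) \<partial>PiM {..<n} (\<lambda>_. E a (\<theta>\<^sub>0 + h / sqrt (real n))))
              - ereal (1 / J)\<bar>) < ereal e"
      using e by (intro order_tendstoD(2)[OF lim[OF H]]) simp
    then have "\<forall>\<^sub>F n in sequentially. local_minimax_risk \<Theta> \<theta>\<^sub>0 Y E \<psi> V n H \<le> ennreal ((1 + e) * b\<^sup>2 * (1 / J + e) + (e\<^sup>2 + e))"
      using eventually_local_target_near[OF deriv e H] eventually_gt_at_top[of 0]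
    proof eventually_elim
      case (elim n)
      show ?case
      proof (rule local_minimax_risk_le[OF V a E, where est="\<lambda>x. b * (sqrt (real n) * (est n x - \<theta>\<^sub>0))"])
        fix h assume h: "h \<in> local_params \<Theta> \<theta>\<^sub>0 n H"
        let ?P = "PiM {..<n} (\<lambda>_. E a (\<theta>\<^sub>0 + h / sqrt (real n)))"
        let ?r = "\<lambda>y. real n * (est n y - (\<theta>\<^sub>0 + h / sqrt (real n)))\<^sup>2"
        have P: "?P \<in> space (prob_algebra (PiM {..<n} (\<lambda>_. Y a)))"
          by (rule prob_space_local_product[OF E[OF a] h])
        then have sets[measurable_cong]: "sets ?P = sets (PiM {..<n} (\<lambda>_. Y a))"
          and prob: "emeasure ?P (space ?P) = 1"
          by (auto simp: space_prob_algebra prob_space.emeasure_space_1)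
        have "\<bar>enn2ereal (\<integral>\<^sup>+y. ennreal (?r y) \<partial>?P) - ereal (1 / J)\<bar> < ereal e"
          by (rule le_less_trans[OF SUP_upper[OF h] elim(1)])
        then have mse: "(\<integral>\<^sup>+y. ennreal (?r y) \<partial>?P) \<le> ennreal (1 / J + e)"
          using J by (intro ennreal_le_of_ereal_dist) auto
        have near: "\<bar>b * h - local_target \<psi> \<theta>\<^sub>0 n h\<bar> \<le> e"
          using elim(2) h by (auto simp: local_params_def abs_minus_commute)
        have "(b * (sqrt (real n) * (est n y - \<theta>\<^sub>0)) - local_target \<psi> \<theta>\<^sub>0 n h)\<^sup>2 \<le> (1 + e) * b\<^sup>2 * ?r y + (e\<^sup>2 + e)" for y
        proof -
          have "b * (sqrt (real n) * (est n y - \<theta>\<^sub>0)) - local_target \<psi> \<theta>\<^sub>0 n h =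
             b * (sqrt (real n) * (est n y - (\<theta>\<^sub>0 + h / sqrt (real n)))) + (b * h - local_target \<psi> \<theta>\<^sub>0 n h)"
            using elim(3) by (simp add: field_simps)
          then have "(b * (sqrt (real n) * (est n y - \<theta>\<^sub>0)) - local_target \<psi> \<theta>\<^sub>0 n h)\<^sup>2 \<le>
             (1 + e) * (b * (sqrt (real n) * (est n y - (\<theta>\<^sub>0 + h / sqrt (real n)))))\<^sup>2
               + (1 + 1 / e) * (b * h - local_target \<psi> \<theta>\<^sub>0 n h)\<^sup>2"
            using power2_sum_le_weighted[OF e] by metis
          also have "\<dots> \<le> (1 + e) * (b * (sqrt (real n) * (est n y - (\<theta>\<^sub>0 + h / sqrt (real n)))))\<^sup>2 + (1 + 1 / e) * e\<^sup>2"
            using near e by (intro add_left_mono mult_left_mono) (auto simp: abs_le_square_iff[symmetric])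
          also have "(1 + 1 / e) * e\<^sup>2 = e\<^sup>2 + e"
            using e by (simp add: field_simps power2_eq_square)
          finally show ?thesis
            by (simp add: power_mult_distrib)
        qed
        then have "(\<integral>\<^sup>+y. ennreal ((b * (sqrt (real n) * (est n y - \<theta>\<^sub>0)) - local_target \<psi> \<theta>\<^sub>0 n h)\<^sup>2) \<partial>?P)
            \<le> (\<integral>\<^sup>+y. ennreal ((1 + e) * b\<^sup>2) * ennreal (?r y) + ennreal (e\<^sup>2 + e) \<partial>?P)"
          using e by (intro nn_integral_mono) (simp add: ennreal_leI flip: ennreal_mult ennreal_plus)
        also have "\<dots> = ennreal ((1 + e) * b\<^sup>2) * (\<integral>\<^sup>+y. ennreal (?r y) \<partial>?P) + ennreal (e\<^sup>2 + e)"
          by (simp add: nn_integral_add nn_integral_cmult prob)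
        also have "\<dots> \<le> ennreal ((1 + e) * b\<^sup>2) * ennreal (1 / J + e) + ennreal (e\<^sup>2 + e)"
          by (intro add_right_mono mult_left_mono mse) simp
        also have "\<dots> = ennreal ((1 + e) * b\<^sup>2 * (1 / J + e) + (e\<^sup>2 + e))"
          using e J by (simp flip: ennreal_mult ennreal_plus)
        finally show "(\<integral>\<^sup>+y. ennreal ((b * (sqrt (real n) * (est n y - \<theta>\<^sub>0)) - local_target \<psi> \<theta>\<^sub>0 n h)\<^sup>2) \<partial>?P)
            \<le> ennreal ((1 + e) * b\<^sup>2 * (1 / J + e) + (e\<^sup>2 + e))" .
      qed auto
    qed
    then show "liminf (\<lambda>n. local_minimax_risk \<Theta> \<theta>\<^sub>0 Y E \<psi> V n H) \<le> ennreal ((1 + e) * b\<^sup>2 * (1 / J + e) + (e\<^sup>2 + e))"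
      by (intro Liminf_le) auto
  qed
  have "(\<lambda>m. ennreal ((1 + 1 / real m) * b\<^sup>2 * (1 / J + 1 / real m) + ((1 / real m)\<^sup>2 + 1 / real m))) \<longlonglongrightarrow>
      ennreal ((1 + 0) * b\<^sup>2 * (1 / J + 0) + (0\<^sup>2 + 0))"
    by (intro tendsto_ennrealI tendsto_intros lim_1_over_n)
  then have "limit_risk \<Theta> \<theta>\<^sub>0 Y E \<psi> V \<le> ennreal ((1 + 0) * b\<^sup>2 * (1 / J + 0) + (0\<^sup>2 + 0))"
    by (rule LIMSEQ_le_const) (use bound in \<open>auto intro!: exI[of _ 1]\<close>)
  then show ?thesis by simp
qed

section \<open>Menu frontier\<close>

lemma limit_risk_eq:
  assumes \<theta>\<^sub>0: "\<theta>\<^sub>0 \<in> interior \<Theta>" and V: "finite V" and a: "a \<in> V"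
    and E: "\<And>a. a \<in> V \<Longrightarrow> statistical_experiment \<Theta> (Y a) (E a)"
    and ge: "\<And>a'. a' \<in> V \<Longrightarrow> blackwell_ge \<Theta> (Y a) (E a) (Y a') (E a')"
    and dqm: "dqm_at \<Theta> (Y a) (E a) \<theta>\<^sub>0 J"
    and eff: "0 < J \<Longrightarrow> has_efficient_estimator \<Theta> (Y a) (E a) \<theta>\<^sub>0 J"
    and deriv: "(\<psi> has_real_derivative b) (at \<theta>\<^sub>0)"
  shows "limit_risk \<Theta> \<theta>\<^sub>0 Y E \<psi> V = (if b \<noteq> 0 then ennreal (b\<^sup>2) / ennreal J else 0)"
proof (cases "b = 0")
  case True
  then show ?thesis using limit_risk_zero[OF V a E] deriv by simp
next
  case False
  have J: "0 \<le> J" by (rule dqm_information_nonneg[OF dqm])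
  have bound: "b\<^sup>2 \<le> J * x" if "limit_risk \<Theta> \<theta>\<^sub>0 Y E \<psi> V < ennreal x" for x
    by (rule limit_risk_information_bound[OF \<theta>\<^sub>0 V a E ge dqm deriv that])
  show ?thesis
  proof (cases "J = 0")
    case True
    \<comment> \<open>A finite bound \<open>x\<close> above the risk would give
      \<open>b\<^sup>2 \<le> 0 * x\<close>.\<close>
    have "limit_risk \<Theta> \<theta>\<^sub>0 Y E \<psi> V = \<top>"
    proof (rule ccontr)
      assume "limit_risk \<Theta> \<theta>\<^sub>0 Y E \<psi> V \<noteq> \<top>"
      then obtain r where r: "limit_risk \<Theta> \<theta>\<^sub>0 Y E \<psi> V = ennreal r" "0 \<le> r"
        by (metis ennreal_cases)
      then have "limit_risk \<Theta> \<theta>\<^sub>0 Y E \<psi> V < ennreal (r + 1)"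
        by (simp add: ennreal_less_iff del: ennreal_plus)
      from bound[OF this] show False
        using False True by simp
    qed
    then show ?thesis
      using False True by simp
  next
    case pos: False
    with J have J: "0 < J" by simp
    have "ennreal (b\<^sup>2 / J) \<le> limit_risk \<Theta> \<theta>\<^sub>0 Y E \<psi> V"
    proof (rule ccontr)
      assume "\<not> ennreal (b\<^sup>2 / J) \<le> limit_risk \<Theta> \<theta>\<^sub>0 Y E \<psi> V"
      \<comment> \<open>The information bound speaks of numbers strictly above the risk, hence the
        intermediate value.\<close>
      then obtain z where z: "limit_risk \<Theta> \<theta>\<^sub>0 Y E \<psi> V < z" "z < ennreal (b\<^sup>2 / J)"
        by (metis not_le dense)
      then obtain x where x: "z = ennreal x" "0 \<le> x"
        by (metis ennreal_cases not_less top_greatest)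
      have "b\<^sup>2 \<le> J * x"
        using z(1) unfolding x(1) by (rule bound)
      moreover have "x < b\<^sup>2 / J"
        using z(2) x by (simp add: ennreal_less_iff)
      ultimately show False
        using J by (simp add: pos_less_divide_eq mult.commute)
    qed
    moreover have "limit_risk \<Theta> \<theta>\<^sub>0 Y E \<psi> V \<le> ennreal (b\<^sup>2 / J)"
      by (rule limit_risk_le_inverse_information[where Y=Y and E=E, OF V a E eff[OF J] J deriv])
    ultimately show ?thesis
      using False J by (simp add: divide_ennreal)
  qed
qed

text \<open>\<open>0 < Js\<close> keeps the subtracted risk finite, so the difference never takes
  the form \<infinity> - \<infinity>.\<close>

lemma risk_difference_eq_info_excess:
  assumes "0 \<le> J" "0 < Js"
  shows "enn2ereal (if b \<noteq> 0 then ennreal (b\<^sup>2) / ennreal J else 0)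
     - enn2ereal (if b \<noteq> 0 then ennreal (b\<^sup>2) / ennreal Js else 0) = info_excess b J Js"
proof (cases "b = 0 \<or> J = 0")
  case True
  then show ?thesis
    using assms by (auto simp: info_excess_def divide_ennreal enn2ereal_ennreal)
next
  case False
  then have "0 < J" using assms by simp
  then show ?thesis
    using False assms by (simp add: info_excess_def divide_ennreal enn2ereal_ennreal right_diff_distrib)
qed

lemma info_excess_antimono:
  assumes "0 \<le> J" "J \<le> J'"
  shows "info_excess b J' Js \<le> info_excess b J Js"
proof (cases "b = 0 \<or> J = 0")
  case False
  then have "1 / J' \<le> 1 / J"
    using assms by (intro divide_left_mono) auto
  then have "b\<^sup>2 * (1 / J' - 1 / Js) \<le> b\<^sup>2 * (1 / J - 1 / Js)"
    by (intro mult_left_mono) auto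
  then show ?thesis
    using False assms by (simp add: info_excess_def)
qed (auto simp: info_excess_def)

section \<open>Compactness and the existence of an optimal menu\<close>

lemma lower_semicontinuous_attains_Inf:
  fixes f :: "'b \<Rightarrow> ereal"
  assumes X: "compact_space X" "topspace X \<noteq> {}" and f: "lower_semicontinuous_map X f"
  shows "\<exists>x\<in>topspace X. f x = (INF y\<in>topspace X. f y)"
proof (rule ccontr)
  let ?m = "INF y\<in>topspace X. f y" and ?U = "\<lambda>c. {x \<in> topspace X. c < f x}"
  assume "\<not> ?thesis"
  then have "?m < f x" if "x \<in> topspace X" for x
    using that INF_lower[of x "topspace X" f] by (auto simp: less_le)
  \<comment> \<open>If \<open>?m\<close> is not attained, the open sets \<open>?U c\<close> with
    \<open>c > ?m\<close> cover the space; the least \<open>c\<close> of a finite subcover bounds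
    \<open>f\<close> below and still exceeds \<open>?m\<close>.\<close>
  then have "topspace X \<subseteq> \<Union>(?U ` {c. ?m < c})"
    using dense by fastforce
  moreover have "\<forall>U\<in>?U ` {c. ?m < c}. openin X U"
    using f by (auto simp: lower_semicontinuous_map_def)
  ultimately obtain \<F> where "finite \<F>" "\<F> \<subseteq> ?U ` {c. ?m < c}" and cover: "topspace X \<subseteq> \<Union>\<F>"
    using X(1) unfolding compact_space_alt by meson
  then obtain C where C: "C \<subseteq> {c. ?m < c}" "finite C" "\<F> = ?U ` C"
    by (meson finite_subset_image)
  with cover X(2) have "C \<noteq> {}" by auto
  with C have "?m < Min C" by auto
  moreover have "Min C \<le> ?m"
  proof (rule INF_greatest)
    fix x assume "x \<in> topspace X"
    then obtain c where "c \<in> C" "c < f x" using cover C by auto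
    then show "Min C \<le> f x" using C Min_le[of C c] by (meson less_imp_le order_trans)
  qed
  ultimately show False by simp
qed

text \<open>Tuples may repeat entries, so menus with fewer than \<open>k\<close> actions are reached
  too; this lets the product topology on tuples stand in for a topology on menus.\<close>

lemma menus_eq_image_tuples:
  assumes k: "1 \<le> k"
  shows "menus A k = (\<lambda>v. v ` {..<k}) ` (PiE {..<k} (\<lambda>_. A))"
proof (intro equalityI subsetI)
  fix V assume "V \<in> menus A k"
  then have V: "V \<subseteq> A" "finite V" "1 \<le> card V" "card V \<le> k" by (auto simp: menus_def)
  obtain g where g: "bij_betw g {0..<card V} V"
    using ex_bij_betw_nat_finite[OF V(2)] by auto
  \<comment> \<open>Surplus positions repeat the action \<open>g 0\<close>, which lies in
    \<open>V\<close> because \<open>V\<close> is nonempty.\<close>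
  define v where "v = (\<lambda>i\<in>{..<k}. g (if i < card V then i else 0))"
  have gV: "g i \<in> V" if "i < card V" for i
    using bij_betwE[OF g] that by auto
  have "v ` {..<k} = V"
  proof (intro equalityI subsetI)
    fix x assume "x \<in> V"
    then have "x \<in> g ` {0..<card V}"
      using g by (simp add: bij_betw_def)
    then obtain i where "i < card V" "x = g i" by auto
    then have "i < k" "v i = x" using V(4) by (auto simp: v_def)
    then show "x \<in> v ` {..<k}" by auto
  qed (use gV V(3) in \<open>auto simp: v_def\<close>)
  moreover have "v \<in> PiE {..<k} (\<lambda>_. A)"
    using gV V(1,3) by (auto simp: v_def)
  ultimately show "V \<in> (\<lambda>v. v ` {..<k}) ` (PiE {..<k} (\<lambda>_. A))"
    by blast
next
  fix V assume "V \<in> (\<lambda>v. v ` {..<k}) ` (PiE {..<k} (\<lambda>_. A))"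
  then obtain v where v: "v \<in> PiE {..<k} (\<lambda>_. A)" "V = v ` {..<k}" by auto
  have "card V \<le> k"
    using card_image_le[of "{..<k}" v] v(2) by simp
  moreover have "V \<noteq> {}" "finite V" "V \<subseteq> A"
    using v k by (auto simp: lessThan_empty_iff)
  ultimately show "V \<in> menus A k"
    by (simp add: menus_def Suc_le_eq card_gt_0_iff)
qed

text \<open>Strict superlevel sets stay open: a supremum over contexts gives a union, a minimum over
  \<open>k\<close> coordinates a finite intersection of preimages under projections. The product of
  \<open>k\<close> copies of a compact action space is compact.\<close>

lemma optimal_menu_exists:
  fixes D :: "'q \<Rightarrow> 'a \<Rightarrow> ereal"
  assumes X: "compact_space X" "topspace X \<noteq> {}" and k: "1 \<le> k"
    and D: "\<And>q. q \<in> Q \<Longrightarrow> lower_semicontinuous_map X (D q)"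
  shows "\<exists>V\<in>menus (topspace X) k. (SUP q\<in>Q. Min (D q ` V)) =
     (INF V\<in>menus (topspace X) k. SUP q\<in>Q. Min (D q ` V))"
proof -
  let ?X = "product_topology (\<lambda>_. X) {..<k}" and ?f = "\<lambda>v. SUP q\<in>Q. Min (D q ` v ` {..<k})"
  have mem: "v i \<in> topspace X" if "v \<in> topspace ?X" "i < k" for v i
    using that by auto
  have "0 < k" using k by simp
  have "lower_semicontinuous_map ?X ?f"
    unfolding lower_semicontinuous_map_def
  proof
    fix c
    have "{v \<in> topspace ?X. c < ?f v} = (\<Union>q\<in>Q. {v \<in> topspace ?X. \<forall>i\<in>{..<k}. c < D q (v i)})"
      using k by (auto simp: less_SUP_iff lessThan_empty_iff simp del: topspace_product_topology)
    also have "openin ?X \<dots>"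
    proof (intro openin_Union ballI, clarify)
      fix q assume q: "q \<in> Q"
      have "{v \<in> topspace ?X. \<forall>i\<in>{..<k}. c < D q (v i)} =
          (\<Inter>i\<in>{..<k}. {v \<in> topspace ?X. v i \<in> {a \<in> topspace X. c < D q a}})"
        using mem \<open>0 < k\<close> by (auto simp del: topspace_product_topology)
      also have "openin ?X \<dots>"
      proof (intro openin_Inter)
        fix S assume "S \<in> (\<lambda>i. {v \<in> topspace ?X. v i \<in> {a \<in> topspace X. c < D q a}}) ` {..<k}"
        then obtain i where i: "i < k" "S = {v \<in> topspace ?X. v i \<in> {a \<in> topspace X. c < D q a}}" by auto
        have "continuous_map ?X X (\<lambda>v. v i)"
          using i(1) by (intro continuous_map_product_projection) auto
        moreover have "openin X {a \<in> topspace X. c < D q a}"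
          using D[OF q] by (simp add: lower_semicontinuous_map_def)
        ultimately show "openin ?X S"
          unfolding i(2) by (rule openin_continuous_map_preimage)
      qed (use k in \<open>auto simp: lessThan_empty_iff\<close>)
      finally show "openin ?X {v \<in> topspace ?X. \<forall>i\<in>{..<k}. c < D q (v i)}" .
    qed
    finally show "openin ?X {v \<in> topspace ?X. c < ?f v}" .
  qed
  moreover have "compact_space ?X"
    using X(1) by (simp add: compact_space_product_topology)
  moreover have "topspace ?X \<noteq> {}"
    using X(2) by (simp add: PiE_eq_empty_iff)
  ultimately obtain v where v: "v \<in> topspace ?X" "?f v = (INF v\<in>topspace ?X. ?f v)"
    using lower_semicontinuous_attains_Inf by blast
  have menus: "menus (topspace X) k = (\<lambda>v. v ` {..<k}) ` topspace ?X"
    using menus_eq_image_tuples[OF k] by simp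
  show ?thesis
  proof (rule bexI)
    show "v ` {..<k} \<in> menus (topspace X) k"
      unfolding menus using v(1) by (rule imageI)
    show "(SUP q\<in>Q. Min (D q ` v ` {..<k})) = (INF V\<in>menus (topspace X) k. SUP q\<in>Q. Min (D q ` V))"
      unfolding menus v(2) by (simp only: image_image)
  qed
qed

lemma lower_semicontinuous_section:
  assumes f: "lower_semicontinuous_map (prod_topology TQ TA) (\<lambda>(q, a). D q a)" and q: "q \<in> topspace TQ"
  shows "lower_semicontinuous_map TA (D q)"
  unfolding lower_semicontinuous_map_def
proof
  fix c
  have "continuous_map TA (prod_topology TQ TA) (\<lambda>a. (q, a))"
    using q by (intro continuous_map_pairedI) auto
  moreover have "openin (prod_topology TQ TA) {x \<in> topspace (prod_topology TQ TA). c < (case x of (q, a) \<Rightarrow> D q a)}"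
    using f by (simp add: lower_semicontinuous_map_def)
  ultimately have "openin TA {a \<in> topspace TA. (q, a) \<in> {x \<in> topspace (prod_topology TQ TA). c < (case x of (q, a) \<Rightarrow> D q a)}}"
    by (rule openin_continuous_map_preimage)
  also have "\<dots> = {a \<in> topspace TA. c < D q a}"
    using q by auto
  finally show "openin TA {a \<in> topspace TA. c < D q a}" .
qed

theorem theorem3p1:
  fixes \<Theta> :: "real set" and \<theta>\<^sub>0 :: real
    and MQ :: "'q measure" and MA :: "'a measure"
    and Y :: "'q \<Rightarrow> 'a \<Rightarrow> 'y measure" and P :: "'q \<Rightarrow> 'a \<Rightarrow> real \<Rightarrow> 'y measure"
    and I :: "'q \<Rightarrow> 'a \<Rightarrow> real" and \<psi> :: "'q \<Rightarrow> real \<Rightarrow> real" and b :: "'q \<Rightarrow> real"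
    and aV :: "'a set \<Rightarrow> 'q \<Rightarrow> 'a" and astar :: "'q \<Rightarrow> 'a"
    and k :: nat
    and L :: "'a set \<Rightarrow> 'q \<Rightarrow> ennreal" and Lstar :: "'q \<Rightarrow> ennreal"
    and D :: "'q \<Rightarrow> 'a \<Rightarrow> ereal" and Ak :: ereal
  assumes interior: "\<theta>\<^sub>0 \<in> interior \<Theta>"
    and actions: "space MA \<noteq> {}"
    and experiments: "\<And>q a. q \<in> space MQ \<Longrightarrow> a \<in> space MA \<Longrightarrow> statistical_experiment \<Theta> (Y q a) (P q a)"
    and dqm: "\<And>q a. q \<in> space MQ \<Longrightarrow> a \<in> space MA \<Longrightarrow> dqm_at \<Theta> (Y q a) (P q a) \<theta>\<^sub>0 (I q a)"
    and lan: "\<And>q a. q \<in> space MQ \<Longrightarrow> a \<in> space MA \<Longrightarrow> lan_at (Y q a) (P q a) \<theta>\<^sub>0 (I q a)"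
    and efficient: "\<And>q a. q \<in> space MQ \<Longrightarrow> a \<in> space MA \<Longrightarrow> I q a > 0 \<Longrightarrow>
          has_efficient_estimator \<Theta> (Y q a) (P q a) \<theta>\<^sub>0 (I q a)"
    and target: "\<And>q. q \<in> space MQ \<Longrightarrow> (\<psi> q has_real_derivative b q) (at \<theta>\<^sub>0)"
    and menu_greatest_measurable:
      "\<And>V. V \<subseteq> space MA \<Longrightarrow> finite V \<Longrightarrow> V \<noteq> {} \<Longrightarrow> aV V \<in> MQ \<rightarrow>\<^sub>M MA"
    and menu_greatest:
      "\<And>V q. V \<subseteq> space MA \<Longrightarrow> finite V \<Longrightarrow> V \<noteq> {} \<Longrightarrow> q \<in> space MQ \<Longrightarrow>
          aV V q \<in> V \<and>
          (\<forall>a\<in>V. blackwell_ge \<Theta> (Y q (aV V q)) (P q (aV V q)) (Y q a) (P q a))"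
    and global_greatest_measurable: "astar \<in> MQ \<rightarrow>\<^sub>M MA"
    and global_greatest:
      "\<And>q a. q \<in> space MQ \<Longrightarrow> a \<in> space MA \<Longrightarrow>
          blackwell_ge \<Theta> (Y q (astar q)) (P q (astar q)) (Y q a) (P q a)"
    and k: "1 \<le> k"
  defines "L \<equiv> \<lambda>V q. limit_risk \<Theta> \<theta>\<^sub>0 (Y q) (P q) (\<psi> q) V"
    and "Lstar \<equiv> \<lambda>q. L {astar q} q"
    and "D \<equiv> \<lambda>q a. info_excess (b q) (I q a) (I q (astar q))"
    and "Ak \<equiv> INF V \<in> menus (space MA) k. SUP q \<in> space MQ. Min (D q ` V)"
  shows
    "(\<forall>q\<in>space MQ. \<forall>V. V \<subseteq> space MA \<and> finite V \<and> V \<noteq> {} \<longrightarrow>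
        L V q = (if b q \<noteq> 0 then ennreal ((b q)\<^sup>2) / ennreal (I q (aV V q)) else 0)) \<and>
     (\<forall>q\<in>space MQ.
        Lstar q = (if b q \<noteq> 0 then ennreal ((b q)\<^sup>2) / ennreal (I q (astar q)) else 0)) \<and>
     ((\<forall>q\<in>space MQ. I q (astar q) > 0) \<longrightarrow>
        (INF V \<in> menus (space MA) k. SUP q \<in> space MQ. enn2ereal (L V q) - enn2ereal (Lstar q)) = Ak) \<and>
     (\<forall>(TQ :: 'q topology) (TA :: 'a topology).
        topspace TQ = space MQ \<and> compact_space TQ \<and>
        topspace TA = space MA \<and> compact_space TA \<and>
        lower_semicontinuous_map (prod_topology TQ TA) (\<lambda>(q, a). D q a) \<longrightarrow>
        (\<exists>V \<in> menus (space MA) k. (SUP q \<in> space MQ. Min (D q ` V)) = Ak))"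
proof (intro conjI ballI allI impI)
  \<comment> \<open>Stated for any Blackwell greatest element \<open>a\<close> of \<open>V\<close>,
    to serve both \<open>aV V q\<close> in a menu and \<open>astar q\<close> in its own
    singleton.\<close>
  have L_eq: "L V q = (if b q \<noteq> 0 then ennreal ((b q)\<^sup>2) / ennreal (I q a) else 0)"
    if "q \<in> space MQ" "V \<subseteq> space MA" "finite V" "a \<in> V"
      "\<And>a'. a' \<in> V \<Longrightarrow> blackwell_ge \<Theta> (Y q a) (P q a) (Y q a') (P q a')" for V q a
    unfolding L_def using that interior experiments dqm efficient target
    by (intro limit_risk_eq[where a=a]) auto
  show menu: "L V q = (if b q \<noteq> 0 then ennreal ((b q)\<^sup>2) / ennreal (I q (aV V q)) else 0)"
    if "q \<in> space MQ" "V \<subseteq> space MA \<and> finite V \<and> V \<noteq> {}" for V q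
    using that menu_greatest by (intro L_eq) auto
  have astar: "astar q \<in> space MA" if "q \<in> space MQ" for q
    using measurable_space[OF global_greatest_measurable that] .
  show star: "Lstar q = (if b q \<noteq> 0 then ennreal ((b q)\<^sup>2) / ennreal (I q (astar q)) else 0)"
    if "q \<in> space MQ" for q
    unfolding Lstar_def using that astar global_greatest by (intro L_eq) auto
  have I_nonneg: "0 \<le> I q a" if "q \<in> space MQ" "a \<in> space MA" for q a
    using dqm[OF that] by (rule dqm_information_nonneg)
  \<comment> \<open>Risks reveal the informations only after division by
    \<open>(b q)\<^sup>2\<close>, hence \<open>b q \<noteq> 0\<close>; contexts with
    \<open>b q = 0\<close> are harmless later because \<open>D q\<close> is 0 there.\<close>
  have I_le: "I q a \<le> I q (aV V q)"
    if q: "q \<in> space MQ" and V: "V \<subseteq> space MA" "finite V" "V \<noteq> {}" and a: "a \<in> V" and b: "b q \<noteq> 0" for q V a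
  proof (cases "I q a = 0")
    case True
    then show ?thesis using I_nonneg[OF q] menu_greatest[OF V q] V(1) by auto
  next
    case False
    then have pos: "0 < I q a" using I_nonneg[OF q, of a] V(1) a by auto
    have "L V q \<le> ennreal ((b q)\<^sup>2 / I q a)"
      unfolding L_def using q V a pos experiments efficient target
      by (intro limit_risk_le_inverse_information[where a=a]) auto
    then have le: "ennreal ((b q)\<^sup>2) / ennreal (I q (aV V q)) \<le> ennreal ((b q)\<^sup>2 / I q a)"
      using menu[OF q, of V] V b by simp
    \<comment> \<open>With zero information at the greatest action the left side of
      \<open>le\<close> would be \<top>.\<close>
    have "0 < I q (aV V q)"
      using I_nonneg[OF q, of "aV V q"] menu_greatest[OF V q] V(1) le b
      by (cases "I q (aV V q) = 0") (auto simp: top_unique)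
    then show ?thesis
      using le b pos by (simp add: divide_ennreal divide_le_cancel field_simps)
  qed
  show "(INF V \<in> menus (space MA) k. SUP q \<in> space MQ. enn2ereal (L V q) - enn2ereal (Lstar q)) = Ak"
    if pos: "\<forall>q\<in>space MQ. I q (astar q) > 0"
    unfolding Ak_def
  proof (intro INF_cong SUP_cong refl)
    fix V q assume V: "V \<in> menus (space MA) k" and q: "q \<in> space MQ"
    then have V: "V \<subseteq> space MA" "finite V" "V \<noteq> {}" by (auto simp: menus_def)
    note a = menu_greatest[OF V q]
    have "enn2ereal (L V q) - enn2ereal (Lstar q) = D q (aV V q)"
      unfolding D_def menu[OF q conjI[OF V(1) conjI[OF V(2,3)]]] star[OF q]
      using I_nonneg[OF q, of "aV V q"] a V(1) pos q by (intro risk_difference_eq_info_excess) auto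
    \<comment> \<open>\<open>info_excess\<close> decreases in the information, so its minimum over
      the menu sits at the most informative action.\<close>
    also have "\<dots> = Min (D q ` V)"
    proof (rule Min_eqI[symmetric])
      fix y assume "y \<in> D q ` V"
      then obtain a' where a': "a' \<in> V" "y = D q a'" by auto
      show "D q (aV V q) \<le> y"
      proof (cases "b q = 0")
        case False
        then show ?thesis
          unfolding a'(2) D_def using I_le[OF q V a'(1)] I_nonneg[OF q, of a'] V(1) a'(1)
          by (intro info_excess_antimono) auto
      qed (simp add: a'(2) D_def info_excess_def)
    qed (use V a in auto)
    finally show "enn2ereal (L V q) - enn2ereal (Lstar q) = Min (D q ` V)" .
  qed
  show "\<exists>V \<in> menus (space MA) k. (SUP q \<in> space MQ. Min (D q ` V)) = Ak"
    if "topspace TQ = space MQ \<and> compact_space TQ \<and>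
        topspace TA = space MA \<and> compact_space TA \<and>
        lower_semicontinuous_map (prod_topology TQ TA) (\<lambda>(q, a). D q a)" for TQ TA
    using optimal_menu_exists[of TA k "space MQ" D] lower_semicontinuous_section[of TQ TA D] that actions k
    unfolding Ak_def by auto
qed

end
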